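(* Let $X$ be a pointed metric space, $E$ a Banach space and $(B(X,E^* ),\|\cdot\|_B)$ a Lipschitz operator Banach space. Then the following are equivalent: (i) There exists a dualizable Lipschitz cross-norm $\alpha$ on $X\boxtimes E$ such that $B(X,E^* )=\mathrm{Lip}_\alpha(X,E^* )$ and $\|f\|_B=\mathrm{Lip}_\alpha(f)$ for every $f\in B(X,E^* )$. (ii) If $f\in\mathrm{Lip}_0(X,E^* )$ and $\{f_\gamma\}_{\gamma\in\Gamma}$ is a bounded net in $B(X,E^* )$ which converges to $f$ in the weak* Lipschitz operator topology of $\mathrm{Lip}_0(X,E^* )$ (that is, $u(f_\gamma)\to u(f)$ for every $u\in X\boxtimes E$), then $f\in B(X,E^* )$ and $\|f\|_B\leq\sup\{\|f_\gamma\|_B\colon\gamma\in\Gamma\}$.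
   Context: $\mathbb{K}$ is $\mathbb R$ or $\mathbb C$. A pointed metric space $X$ is a metric space with metric $d$ and a designated base point $0$; a normed space is pointed by its zero vector. For a Banach space $F$, $\mathrm{Lip}_0(X,F)$ is the space of base-point preserving Lipschitz maps $X\to F$, with norm $\mathrm{Lip}$ (least Lipschitz constant); $X^\#=\mathrm{Lip}_0(X,\mathbb K)$; $E^*$ is the topological dual. The Lipschitz tensor product $X\boxtimes E$ is the linear span of all linear functionals $\delta_{(x,y)}\boxtimes e$ on $\mathrm{Lip}_0(X,E^* )$ of the form $(\delta_{(x,y)}\boxtimes e)(f)=\langle f(x)-f(y),e\rangle$, for $x,y\in X$ and $e\in E$. A norm $\alpha$ on $X\boxtimes E$ is a Lipschitz cross-norm if $\alpha(\delta_{(x,y)}\boxtimes e)=d(x,y)\|e\|$ always. It is dualizable if $\left|\sum_{i=1}^n(g(x_i)-g(y_i))\langle\phi,e_i\rangle\right|\le\mathrm{Lip}(g)\|\phi\|\,\alpha\left(\sum_{i=1}^n\delta_{(x_i,y_i)}\boxtimes e_i\right)$ for all $g\in X^\#$, $\phi\in E^*$ and $\sum_i\delta_{(x_i,y_i)}\boxtimes e_i\in X\boxtimes E$. A base-point preserving map $f\colon X\to E^*$ is an $\alpha$-Lipschitz operator if there is $C\ge 0$ with $\left|\sum_{i=1}^n\langle f(x_i)-f(y_i),e_i\rangle\right|\le C\,\alpha\left(\sum_{i=1}^n\delta_{(x_i,y_i)}\boxtimes e_i\right)$ for all $\sum_{i=1}^n\delta_{(x_i,y_i)}\boxtimes e_i\in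 X\boxtimes E$; the infimum of such $C$ is $\mathrm{Lip}_\alpha(f)$, and $\mathrm{Lip}_\alpha(X,E^* )$ is the set of all such maps. A Lipschitz operator Banach space from $X$ to $E^*$ is a linear subspace $B(X,E^* )$ of $\mathrm{Lip}_0(X,E^* )$ with a norm $\|\cdot\|_B$ such that: (1) $(B(X,E^* ),\|\cdot\|_B)$ is a Banach space; (2) $\|f\|_B\ge\mathrm{Lip}(f)$ for every $f\in B(X,E^* )$; (3) for every $g\in X^\#$ and $\phi\in E^*$, the map $g\cdot\phi\colon x\mapsto g(x)\phi$ belongs to $B(X,E^* )$ and $\|g\cdot\phi\|_B=\mathrm{Lip}(g)\|\phi\|$. The weak* Lipschitz operator topology on $\mathrm{Lip}_0(X,E^* )$ is the topology induced by the linear space $X\boxtimes E$ of linear functionals on it. "Bounded net in $B(X,E^* )$" means bounded in the norm $\|\cdot\|_B$. *)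

theory Defs
  imports "HOL-Analysis.Analysis" "HOL-Library.Function_Algebras"
begin

text \<open>The scalar field: a normed field isometrically isomorphic to the reals or to the
  complex numbers.\<close>

class real_or_complex = real_normed_field +
  assumes ex_embedding_complex:
    "\<exists>h :: 'a \<Rightarrow> complex. (\<forall>a b. h (a + b) = h a + h b) \<and> (\<forall>r a. h (r *\<^sub>R a) = r *\<^sub>R h a) \<and>
       (\<forall>a b. h (a * b) = h a * h b) \<and>
       (\<forall>a. norm (h a) = norm a) \<and> (range h = \<real> \<or> range h = UNIV)"

instance real :: real_or_complex
proof
  show "\<exists>h :: real \<Rightarrow> complex. (\<forall>a b. h (a + b) = h a + h b) \<and> (\<forall>r a. h (r *\<^sub>R a) = r *\<^sub>R h a) \<and>
       (\<forall>a b. h (a * b) = h a * h b) \<and>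
       (\<forall>a. norm (h a) = norm a) \<and> (range h = \<real> \<or> range h = UNIV)"
    by (rule exI[of _ complex_of_real]) (auto simp: Reals_def scaleR_conv_of_real)
qed

instance complex :: real_or_complex
proof
  show "\<exists>h :: complex \<Rightarrow> complex. (\<forall>a b. h (a + b) = h a + h b) \<and> (\<forall>r a. h (r *\<^sub>R a) = r *\<^sub>R h a) \<and>
       (\<forall>a b. h (a * b) = h a * h b) \<and>
       (\<forall>a. norm (h a) = norm a) \<and> (range h = \<real> \<or> range h = UNIV)"
    by (rule exI[of _ "\<lambda>z. z"]) auto
qed

text \<open>A Banach space over \<open>'k\<close>. The library's \<open>banach\<close> class only knows real scalars, so
  the scalar multiplication by \<open>'k\<close> is an explicit parameter extending \<open>scaleR\<close>.\<close>

locale banach_over = vector_space smul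
  for smul :: "'k::real_or_complex \<Rightarrow> 'e::banach \<Rightarrow> 'e" +
  assumes norm_smul: "norm (smul a e) = norm a * norm e"
    and smul_of_real: "smul (of_real r) e = r *\<^sub>R e"

text \<open>\<open>'e \<Rightarrow>\<^sub>L 'k\<close> consists of the bounded real-linear maps; the topological dual \<open>E\<^sup>*\<close>
  is the subset of the \<open>'k\<close>-linear ones, and its norm is the norm of \<open>'e \<Rightarrow>\<^sub>L 'k\<close>.\<close>

definition dual :: "('k \<Rightarrow> 'e \<Rightarrow> 'e) \<Rightarrow> ('e::banach \<Rightarrow>\<^sub>L 'k::real_or_complex) set" where
  "dual smul = {\<phi>. \<forall>a e. blinfun_apply \<phi> (smul a e) = a * blinfun_apply \<phi> e}"

definition dual_scale :: "'k \<Rightarrow> ('e::banach \<Rightarrow>\<^sub>L 'k) \<Rightarrow> ('e \<Rightarrow>\<^sub>L 'k::real_or_complex)" where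
  "dual_scale a \<phi> = blinfun_mult_right a o\<^sub>L \<phi>"

lemma dual_scale_apply: "blinfun_apply (dual_scale a \<phi>) e = a * blinfun_apply \<phi> e"
  by (simp add: dual_scale_def)

definition op_scale ::
  "'k \<Rightarrow> ('x \<Rightarrow> ('e::banach \<Rightarrow>\<^sub>L 'k)) \<Rightarrow> ('x \<Rightarrow> ('e \<Rightarrow>\<^sub>L 'k::real_or_complex))" where
  "op_scale a f = (\<lambda>x. dual_scale a (f x))"

definition functional_scale :: "'k \<Rightarrow> ('f \<Rightarrow> 'k) \<Rightarrow> ('f \<Rightarrow> 'k::real_or_complex)" where
  "functional_scale a u = (\<lambda>f. a * u f)"

lemma vector_space_op_scale: "vector_space op_scale"
  by unfold_locales
     (auto simp: op_scale_def fun_eq_iff dual_scale_apply blinfun.add_left algebra_simps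
        intro!: blinfun_eqI)

lemma vector_space_functional_scale: "vector_space functional_scale"
  by unfold_locales (auto simp: functional_scale_def fun_eq_iff algebra_simps)

definition norm_on :: "('k::real_normed_field \<Rightarrow> 'v::ab_group_add \<Rightarrow> 'v) \<Rightarrow> 'v set \<Rightarrow> ('v \<Rightarrow> real) \<Rightarrow> bool"
  where "norm_on s V N \<longleftrightarrow>
    (\<forall>v\<in>V. 0 \<le> N v) \<and> (\<forall>v\<in>V. N v = 0 \<longleftrightarrow> v = 0) \<and>
    (\<forall>v\<in>V. \<forall>w\<in>V. N (v + w) \<le> N v + N w) \<and> (\<forall>a. \<forall>v\<in>V. N (s a v) = norm a * N v)"

definition complete_norm_on :: "'v::ab_group_add set \<Rightarrow> ('v \<Rightarrow> real) \<Rightarrow> bool" where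
  "complete_norm_on V N \<longleftrightarrow>
    (\<forall>v :: nat \<Rightarrow> 'v. (\<forall>n. v n \<in> V) \<and> (\<forall>\<epsilon>>0. \<exists>n0. \<forall>m\<ge>n0. \<forall>n\<ge>n0. N (v m - v n) < \<epsilon>) \<longrightarrow>
       (\<exists>w\<in>V. (\<lambda>n. N (v n - w)) \<longlonglongrightarrow> 0))"

text \<open>Here \<open>x0\<close> is the base point of \<open>X\<close> and the codomain is given by its carrier \<open>F\<close>.\<close>

definition Lip0 :: "'x::metric_space \<Rightarrow> 'f::real_normed_vector set \<Rightarrow> ('x \<Rightarrow> 'f) set" where
  "Lip0 x0 F = {f. f x0 = 0 \<and> range f \<subseteq> F \<and> (\<exists>C. C-lipschitz_on UNIV f)}"

definition Lip :: "('x::metric_space \<Rightarrow> 'f::real_normed_vector) \<Rightarrow> real" where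
  "Lip f = Inf {C. C-lipschitz_on UNIV f}"

text \<open>Functionals on \<open>Lip\<^sub>0(X, E\<^sup>*)\<close> are represented as functions vanishing outside this set, so
  that two of them are equal in HOL iff they agree on \<open>Lip\<^sub>0(X, E\<^sup>*)\<close>.\<close>

definition elem_tensor ::
  "'x \<Rightarrow> ('k \<Rightarrow> 'e \<Rightarrow> 'e) \<Rightarrow> 'x \<Rightarrow> 'x \<Rightarrow> 'e \<Rightarrow>
   ('x::metric_space \<Rightarrow> ('e::banach \<Rightarrow>\<^sub>L 'k)) \<Rightarrow> 'k::real_or_complex" where
  "elem_tensor x0 smul x y e =
    (\<lambda>f. if f \<in> Lip0 x0 (dual smul) then blinfun_apply (f x - f y) e else 0)"

definition lip_tensor ::
  "'x \<Rightarrow> ('k \<Rightarrow> 'e \<Rightarrow> 'e) \<Rightarrow>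
   (('x::metric_space \<Rightarrow> ('e::banach \<Rightarrow>\<^sub>L 'k)) \<Rightarrow> 'k::real_or_complex) set" where
  "lip_tensor x0 smul =
    module.span functional_scale {elem_tensor x0 smul x y e | x y e. True}"

definition lip_cross_norm ::
  "'x \<Rightarrow> ('k \<Rightarrow> 'e \<Rightarrow> 'e) \<Rightarrow>
   ((('x::metric_space \<Rightarrow> ('e::banach \<Rightarrow>\<^sub>L 'k)) \<Rightarrow> 'k::real_or_complex) \<Rightarrow> real) \<Rightarrow> bool" where
  "lip_cross_norm x0 smul \<alpha> \<longleftrightarrow>
    norm_on functional_scale (lip_tensor x0 smul) \<alpha> \<and>
    (\<forall>x y e. \<alpha> (elem_tensor x0 smul x y e) = dist x y * norm e)"

definition dualizable ::
  "'x \<Rightarrow> ('k \<Rightarrow> 'e \<Rightarrow> 'e) \<Rightarrow>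
   ((('x::metric_space \<Rightarrow> ('e::banach \<Rightarrow>\<^sub>L 'k)) \<Rightarrow> 'k::real_or_complex) \<Rightarrow> real) \<Rightarrow> bool" where
  "dualizable x0 smul \<alpha> \<longleftrightarrow>
    (\<forall>g \<in> Lip0 x0 (UNIV :: 'k set). \<forall>\<phi> \<in> dual smul. \<forall>(n::nat) x y e.
       norm (\<Sum>i<n. (g (x i) - g (y i)) * blinfun_apply \<phi> (e i))
         \<le> Lip g * norm \<phi> * \<alpha> (\<Sum>i<n. elem_tensor x0 smul (x i) (y i) (e i)))"

definition alpha_bound ::
  "'x \<Rightarrow> ('k \<Rightarrow> 'e \<Rightarrow> 'e) \<Rightarrow>
   ((('x::metric_space \<Rightarrow> ('e::banach \<Rightarrow>\<^sub>L 'k)) \<Rightarrow> 'k::real_or_complex) \<Rightarrow> real) \<Rightarrow>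
   ('x \<Rightarrow> ('e \<Rightarrow>\<^sub>L 'k)) \<Rightarrow> real \<Rightarrow> bool" where
  "alpha_bound x0 smul \<alpha> f C \<longleftrightarrow> 0 \<le> C \<and>
    (\<forall>(n::nat) x y e. norm (\<Sum>i<n. blinfun_apply (f (x i) - f (y i)) (e i))
         \<le> C * \<alpha> (\<Sum>i<n. elem_tensor x0 smul (x i) (y i) (e i)))"

definition Lip_alpha ::
  "'x \<Rightarrow> ('k \<Rightarrow> 'e \<Rightarrow> 'e) \<Rightarrow>
   ((('x::metric_space \<Rightarrow> ('e::banach \<Rightarrow>\<^sub>L 'k)) \<Rightarrow> 'k::real_or_complex) \<Rightarrow> real) \<Rightarrow>
   ('x \<Rightarrow> ('e \<Rightarrow>\<^sub>L 'k)) set" where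
  "Lip_alpha x0 smul \<alpha> =
    {f. f x0 = 0 \<and> range f \<subseteq> dual smul \<and> (\<exists>C. alpha_bound x0 smul \<alpha> f C)}"

definition Lip_alpha_norm ::
  "'x \<Rightarrow> ('k \<Rightarrow> 'e \<Rightarrow> 'e) \<Rightarrow>
   ((('x::metric_space \<Rightarrow> ('e::banach \<Rightarrow>\<^sub>L 'k)) \<Rightarrow> 'k::real_or_complex) \<Rightarrow> real) \<Rightarrow>
   ('x \<Rightarrow> ('e \<Rightarrow>\<^sub>L 'k)) \<Rightarrow> real" where
  "Lip_alpha_norm x0 smul \<alpha> f = Inf {C. alpha_bound x0 smul \<alpha> f C}"

definition lip_operator_banach ::
  "'x \<Rightarrow> ('k \<Rightarrow> 'e \<Rightarrow> 'e) \<Rightarrow> ('x::metric_space \<Rightarrow> ('e::banach \<Rightarrow>\<^sub>L 'k::real_or_complex)) set \<Rightarrow>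
   (('x \<Rightarrow> ('e \<Rightarrow>\<^sub>L 'k)) \<Rightarrow> real) \<Rightarrow> bool" where
  "lip_operator_banach x0 smul B normB \<longleftrightarrow>
    B \<subseteq> Lip0 x0 (dual smul) \<and> module.subspace op_scale B \<and>
    norm_on op_scale B normB \<and> complete_norm_on B normB \<and>
    (\<forall>f\<in>B. Lip f \<le> normB f) \<and>
    (\<forall>g \<in> Lip0 x0 (UNIV :: 'k set). \<forall>\<phi> \<in> dual smul.
       (\<lambda>x. dual_scale (g x) \<phi>) \<in> B \<and> normB (\<lambda>x. dual_scale (g x) \<phi>) = Lip g * norm \<phi>)"

text \<open>The initial topology on \<open>Lip\<^sub>0(X, E\<^sup>*)\<close> with respect to the functionals in the tensor product.\<close>

definition weak_star_lip_topology ::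
  "'x \<Rightarrow> ('k \<Rightarrow> 'e \<Rightarrow> 'e) \<Rightarrow> ('x::metric_space \<Rightarrow> ('e::banach \<Rightarrow>\<^sub>L 'k::real_or_complex)) topology" where
  "weak_star_lip_topology x0 smul = topology_generated_by
    {{f \<in> Lip0 x0 (dual smul). u f \<in> U} | u U. u \<in> lip_tensor x0 smul \<and> open U}"

definition directed_set :: "'i set \<Rightarrow> ('i \<Rightarrow> 'i \<Rightarrow> bool) \<Rightarrow> bool" where
  "directed_set \<Gamma> le \<longleftrightarrow> \<Gamma> \<noteq> {} \<and> (\<forall>i\<in>\<Gamma>. le i i) \<and>
    (\<forall>i\<in>\<Gamma>. \<forall>j\<in>\<Gamma>. \<forall>k\<in>\<Gamma>. le i j \<longrightarrow> le j k \<longrightarrow> le i k) \<and>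
    (\<forall>i\<in>\<Gamma>. \<forall>j\<in>\<Gamma>. \<exists>k\<in>\<Gamma>. le i k \<and> le j k)"

text \<open>A net indexed by \<open>\<Gamma>\<close> converges iff it converges along the filter of tails of \<open>\<Gamma>\<close>.\<close>

definition tails :: "'i set \<Rightarrow> ('i \<Rightarrow> 'i \<Rightarrow> bool) \<Rightarrow> 'i filter" where
  "tails \<Gamma> le = (INF i\<in>\<Gamma>. principal {j\<in>\<Gamma>. le i j})"

lemma eventually_tails:
  assumes "directed_set \<Gamma> le"
  shows "eventually P (tails \<Gamma> le) \<longleftrightarrow> (\<exists>i\<in>\<Gamma>. \<forall>j\<in>\<Gamma>. le i j \<longrightarrow> P j)"
proof -
  have "eventually P (tails \<Gamma> le) \<longleftrightarrow> (\<exists>i\<in>\<Gamma>. eventually P (principal {j\<in>\<Gamma>. le i j}))"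
    unfolding tails_def
  proof (rule eventually_INF_base)
    show "\<Gamma> \<noteq> {}" using assms by (simp add: directed_set_def)
    fix i j assume ij: "i \<in> \<Gamma>" "j \<in> \<Gamma>"
    then obtain k where k: "k \<in> \<Gamma>" "le i k" "le j k"
      using assms unfolding directed_set_def by blast
    have "{l\<in>\<Gamma>. le k l} \<subseteq> {l\<in>\<Gamma>. le i l} \<inter> {l\<in>\<Gamma>. le j l}"
      using assms ij k unfolding directed_set_def by blast
    then show "\<exists>k\<in>\<Gamma>. principal {l\<in>\<Gamma>. le k l}
        \<le> inf (principal {l\<in>\<Gamma>. le i l}) (principal {l\<in>\<Gamma>. le j l})"
      using k(1) by auto
  qed
  then show ?thesis by (auto simp: eventually_principal)
qed

lemma limitin_weak_star_lip_topology:
  fixes F :: "'i \<Rightarrow> 'x::metric_space \<Rightarrow> ('e::banach \<Rightarrow>\<^sub>L 'k::real_or_complex)"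
  assumes \<Gamma>: "directed_set \<Gamma> le" and F: "\<And>i. i \<in> \<Gamma> \<Longrightarrow> F i \<in> Lip0 x0 (dual smul)"
    and f: "f \<in> Lip0 x0 (dual smul)"
  shows "limitin (weak_star_lip_topology x0 smul) F f (tails \<Gamma> le) \<longleftrightarrow>
    (\<forall>u \<in> lip_tensor x0 smul. ((\<lambda>i. u (F i)) \<longlongrightarrow> u f) (tails \<Gamma> le))"
    (is "?L \<longleftrightarrow> ?R")
proof -
  let ?S = "{{f \<in> Lip0 x0 (dual smul). u f \<in> U} | u U. u \<in> lip_tensor x0 smul \<and> open U}"
  have evF: "eventually (\<lambda>i. F i \<in> Lip0 x0 (dual smul)) (tails \<Gamma> le)"
    using \<Gamma> F unfolding eventually_tails[OF \<Gamma>] directed_set_def by blast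
  have z: "0 \<in> lip_tensor x0 smul"
    unfolding lip_tensor_def
    by (intro module.span_zero)
       (use vector_space_functional_scale in \<open>simp add: module_iff_vector_space\<close>)
  have "Lip0 x0 (dual smul) \<in> ?S"
    using z by (auto intro!: exI[of _ 0] exI[of _ UNIV])
  then have ft: "f \<in> topspace (weak_star_lip_topology x0 smul)"
    using f unfolding weak_star_lip_topology_def topology_generated_by_topspace by blast
  show ?thesis
  proof
    assume L: ?L
    show ?R
    proof (intro ballI topological_tendstoI)
      fix u and U :: "'k set"
      assume u: "u \<in> lip_tensor x0 smul" and U: "open U" "u f \<in> U"
      have "openin (weak_star_lip_topology x0 smul) {f \<in> Lip0 x0 (dual smul). u f \<in> U}"
        unfolding weak_star_lip_topology_def
        by (rule topology_generated_by_Basis) (use u U in blast)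
      with L f U have "eventually (\<lambda>i. F i \<in> {f \<in> Lip0 x0 (dual smul). u f \<in> U}) (tails \<Gamma> le)"
        unfolding limitin_def by blast
      then show "eventually (\<lambda>i. u (F i) \<in> U) (tails \<Gamma> le)"
        by (rule eventually_mono) simp
    qed
  next
    assume R: ?R
    have "f \<in> W \<longrightarrow> eventually (\<lambda>i. F i \<in> W) (tails \<Gamma> le)"
      if "generate_topology_on ?S W" for W
      using that
    proof induction
      case Empty
      then show ?case by simp
    next
      case (Int a b)
      then show ?case by (auto intro: eventually_conj)
    next
      case (UN K)
      show ?case
      proof
        assume "f \<in> \<Union>K"
        then obtain k where k: "k \<in> K" "f \<in> k" by blast
        then have "eventually (\<lambda>i. F i \<in> k) (tails \<Gamma> le)" using UN by blast
        then show "eventually (\<lambda>i. F i \<in> \<Union>K) (tails \<Gamma> le)"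
          by (rule eventually_mono) (use k in blast)
      qed
    next
      case (Basis s)
      then obtain u U where s: "s = {f \<in> Lip0 x0 (dual smul). u f \<in> U}"
        and u: "u \<in> lip_tensor x0 smul" and U: "open U" by blast
      show ?case
      proof
        assume "f \<in> s"
        then have "eventually (\<lambda>i. u (F i) \<in> U) (tails \<Gamma> le)"
          using R u U s by (auto dest: topological_tendstoD)
        with evF show "eventually (\<lambda>i. F i \<in> s) (tails \<Gamma> le)"
          by eventually_elim (simp add: s)
      qed
    qed
    then show ?L
      using ft unfolding limitin_def weak_star_lip_topology_def openin_topology_generated_by_iff
      by blast
  qed
qed

text \<open>Nets are indexed by directed subsets of the following type, where \<open>'g\<close> is arbitrary: a
  formula cannot quantify over all index types, but since \<open>'g\<close> is a free type variable of
  the theorem, every directed set occurs for some instance of \<open>'g\<close>. The other summand ensures that,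
  whatever \<open>'g\<close> is, there are enough indices for nets of neighbourhoods in
  \<open>Lip\<^sub>0(X, E\<^sup>*)\<close>, ordered by reverse inclusion.\<close>

type_synonym ('x, 'e, 'k, 'g) net_index = "('x \<Rightarrow> ('e \<Rightarrow>\<^sub>L 'k)) set + 'g"

end

theory Submission
  imports Defs
begin

text \<open>Condition (i) says that \<open>B\<close> is, isometrically, the dual of the tensor product normed by \<open>\<alpha>\<close>,
  and condition (ii) that the closed balls of \<open>B\<close> are closed in the topology of pointwise
  convergence on the tensor product. The equivalence is thus an instance of the bipolar theorem.

  If (i) holds, the ball of radius \<open>C\<close> is cut out by the inequalities \<open>norm (u f) \<le> C * \<alpha> u\<close>, one
  for each tensor \<open>u\<close>, and each of them is preserved by limits of \<open>u f\<close>
  (\<open>Lip_alpha_weak_star_limit\<close>).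

  Conversely, let \<open>\<alpha> u\<close> be the supremum of \<open>norm (u f)\<close> over the unit ball of \<open>B\<close>
  (\<open>predual_norm\<close>). It is finite because \<open>B\<close> dominates the Lipschitz constant. It is a dualizable
  cross-norm because \<open>B\<close> contains the rank-one maps \<open>g \<cdot> \<phi>\<close> with the right norm; here \<open>E\<close> must have
  enough functionals, which is the Hahn-Banach theorem over the reals or the complex numbers
  (\<open>ex_norming_dual\<close>). By construction the maps in \<open>B\<close> of norm at most \<open>C\<close> satisfy
  \<open>norm (u f) \<le> C * \<alpha> u\<close>. For the converse, any \<open>f\<close> that satisfies these inequalities is
  approximated by the ball of radius \<open>C\<close> on any finite set of tensors: otherwise the values of \<open>f\<close>
  on these tensors could be separated from those of the ball, and the combination of the tensors
  given by the separating functional would violate the inequality (\<open>ball_approximates\<close>). Such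
  approximations form a net converging to \<open>f\<close> (\<open>ball_weak_star_dense\<close>), so (ii) puts \<open>f\<close> into the
  ball.\<close>

section \<open>Linear functionals below a sublinear one\<close>

definition sublinear :: "('v::real_vector \<Rightarrow> real) \<Rightarrow> bool" where
  "sublinear q \<longleftrightarrow> (\<forall>x y. q (x + y) \<le> q x + q y) \<and> (\<forall>r\<ge>0. \<forall>x. q (r *\<^sub>R x) = r * q x)"

lemma sublinearD:
  assumes "sublinear q"
  shows "q (x + y) \<le> q x + q y" and "r \<ge> 0 \<Longrightarrow> q (r *\<^sub>R x) = r * q x" and "q 0 = 0"
    and "- q (- x) \<le> q x"
proof -
  show add: "q (x + y) \<le> q x + q y" for x y
    using assms by (simp add: sublinear_def)
  show scale: "q (r *\<^sub>R x) = r * q x" if "r \<ge> 0" for r x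
    using assms that by (simp add: sublinear_def)
  from scale[of 0 0] show 0: "q 0 = 0" by simp
  from add[of x "- x"] show "- q (- x) \<le> q x" by (simp add: 0)
qed

lemma sublinearI:
  assumes add: "\<And>x y. q (x + y) \<le> q x + q y" and 0: "q 0 = 0"
    and scale: "\<And>r x. r > 0 \<Longrightarrow> q (r *\<^sub>R x) \<le> r * q x"
  shows "sublinear q"
proof -
  have "q (r *\<^sub>R x) = r * q x" if "r \<ge> 0" for r x
  proof (cases "r = 0")
    case False
    with that have r: "r > 0" by simp
    from scale[of "inverse r" "r *\<^sub>R x"] r have "r * q x \<le> r * (inverse r * q (r *\<^sub>R x))"
      by (intro mult_left_mono) auto
    with scale[OF r, of x] r show ?thesis by (simp add: field_simps)
  qed (simp add: 0)
  with add show ?thesis by (simp add: sublinear_def)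
qed

text \<open>For \<open>t \<ge> 0\<close>, any linear functional \<open>f\<close> with \<open>f \<le> q\<close> and \<open>f y = q y\<close> satisfies
  \<open>f x = f (x + t y) - t f y \<le> q (x + t y) - t q y\<close>. The infimum of these bounds is again
  sublinear, lies below \<open>q\<close>, and its value at \<open>- y\<close> is at most \<open>- q y\<close>: passing from \<open>q\<close> to
  \<open>slide q y\<close> makes the functional linear along \<open>y\<close>.\<close>

definition slide :: "('v::real_vector \<Rightarrow> real) \<Rightarrow> 'v \<Rightarrow> 'v \<Rightarrow> real" where
  "slide q y x = (INF t\<in>{0..}. q (x + t *\<^sub>R y) - t * q y)"

context
  fixes q :: "'v::real_vector \<Rightarrow> real"
  assumes q: "sublinear q"
begin

lemma slide_le:
  assumes "t \<ge> 0"
  shows "slide q y x \<le> q (x + t *\<^sub>R y) - t * q y"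
proof -
  have "- q (- x) \<le> q (x + s *\<^sub>R y) - s * q y" if "s \<ge> 0" for s
    using sublinearD(1)[OF q, of "x + s *\<^sub>R y" "- x"] sublinearD(2)[OF q that, of y] by simp
  then have "bdd_below ((\<lambda>t. q (x + t *\<^sub>R y) - t * q y) ` {0..})"
    by (intro bdd_belowI2[where m = "- q (- x)"]) auto
  then show ?thesis
    unfolding slide_def by (rule cINF_lower) (use assms in simp)
qed

lemma le_slide:
  assumes "\<And>t. t \<ge> 0 \<Longrightarrow> c \<le> q (x + t *\<^sub>R y) - t * q y"
  shows "c \<le> slide q y x"
  unfolding slide_def by (rule cINF_greatest) (use assms in auto)

lemma sublinear_slide: "sublinear (slide q y)"
proof (rule sublinearI)
  fix x z
  have "slide q y (x + z) - (q (x + s *\<^sub>R y) - s * q y) \<le> slide q y z" if s: "s \<ge> 0" for s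
  proof (rule le_slide)
    fix t :: real assume t: "t \<ge> 0"
    have "slide q y (x + z) \<le> q ((x + s *\<^sub>R y) + (z + t *\<^sub>R y)) - (s + t) * q y"
      using slide_le[of "s + t" y "x + z"] s t by (simp add: algebra_simps)
    also have "\<dots> \<le> q (x + s *\<^sub>R y) + q (z + t *\<^sub>R y) - (s + t) * q y"
      using sublinearD(1)[OF q] by simp
    finally show "slide q y (x + z) - (q (x + s *\<^sub>R y) - s * q y) \<le> q (z + t *\<^sub>R y) - t * q y"
      by (simp add: algebra_simps)
  qed
  then have "slide q y (x + z) - slide q y z \<le> slide q y x"
    by (intro le_slide) (simp add: algebra_simps)
  then show "slide q y (x + z) \<le> slide q y x + slide q y z" by simp
next
  have "q (0 + t *\<^sub>R y) - t * q y = 0" if "t \<ge> 0" for t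
    using sublinearD(2)[OF q that] by simp
  then show "slide q y 0 = 0" unfolding slide_def by simp
next
  fix r :: real and x assume r: "r > 0"
  have "slide q y (r *\<^sub>R x) / r \<le> slide q y x"
  proof (rule le_slide)
    fix t :: real assume "t \<ge> 0"
    then have "slide q y (r *\<^sub>R x) \<le> q (r *\<^sub>R (x + t *\<^sub>R y)) - r * t * q y"
      using slide_le[of "r * t" y "r *\<^sub>R x"] r by (simp add: algebra_simps)
    also have "\<dots> = r * (q (x + t *\<^sub>R y) - t * q y)"
      using sublinearD(2)[OF q, of r "x + t *\<^sub>R y"] r by (simp add: right_diff_distrib)
    finally show "slide q y (r *\<^sub>R x) / r \<le> q (x + t *\<^sub>R y) - t * q y"
      using r by (simp add: field_simps)
  qed
  then show "slide q y (r *\<^sub>R x) \<le> r * slide q y x" using r by (simp add: field_simps)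
qed

text \<open>A minimal \<open>q\<close> is left unchanged by sliding along any \<open>y\<close>, and
  \<open>slide q y x \<le> q (x + y) - q y\<close> then is the reverse of the triangle inequality.\<close>

lemma linear_if_minimal_sublinear:
  assumes min: "\<And>q'. sublinear q' \<Longrightarrow> (\<And>x. q' x \<le> q x) \<Longrightarrow> q' = q"
  shows "linear q"
proof (rule linearI)
  show add: "q (x + y) = q x + q y" for x y
  proof -
    have "slide q y = q"
    proof (rule min[OF sublinear_slide])
      show "slide q y x \<le> q x" for x using slide_le[of 0 y x] by simp
    qed
    with slide_le[of 1 y x] have "q x + q y \<le> q (x + y)" by simp
    with sublinearD(1)[OF q, of x y] show ?thesis by simp
  qed
  have neg: "q (- x) = - q x" for x
    using add[of x "- x"] sublinearD(3)[OF q] by simp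
  show "q (r *\<^sub>R x) = r *\<^sub>R q x" for r x
  proof (cases "r \<ge> 0")
    case True
    then show ?thesis using sublinearD(2)[OF q] by simp
  next
    case False
    then have "q ((- r) *\<^sub>R x) = (- r) * q x" by (intro sublinearD(2)[OF q]) simp
    then show ?thesis using neg[of "r *\<^sub>R x"] by simp
  qed
qed

end

text \<open>The Hahn-Banach theorem in the form needed here. Zorn's lemma is applied to the sublinear
  functionals below \<open>p\<close>, ordered by \<open>\<ge>\<close>, so that no extension of functionals from subspaces
  is involved. The infimum of a chain is finite because \<open>- p (- x) \<le> - q (- x) \<le> q x\<close>.\<close>

lemma ex_linear_le_sublinear:
  fixes p :: "'v::real_vector \<Rightarrow> real"
  assumes p: "sublinear p"
  obtains f where "linear f" "\<And>x. f x \<le> p x"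
proof -
  define A where "A = {q. sublinear q \<and> (\<forall>x. q x \<le> p x)}"
  define P where "P = (\<lambda>a b :: 'v \<Rightarrow> real. \<forall>x. b x \<le> a x)"
  have "\<exists>m\<in>A. \<forall>a\<in>A. P m a \<longrightarrow> a = m"
  proof (rule predicate_Zorn)
    show "partial_order_on A (relation_of P A)"
      by (rule partial_order_on_relation_ofI) (auto simp: P_def fun_eq_iff intro: order_trans order_antisym)
  next
    fix C assume C: "C \<in> Chains (relation_of P A)"
    then have CA: "C \<subseteq> A" by (rule Chains_relation_of)
    have tot: "P a b \<or> P b a" if "a \<in> C" "b \<in> C" for a b
      using C that unfolding Chains_def relation_of_def by auto
    show "\<exists>u\<in>A. \<forall>a\<in>C. P a u"
    proof (cases "C = {}")
      case True
      then show ?thesis using p by (auto simp: A_def)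
    next
      case False
      define u where "u = (\<lambda>x. INF q\<in>C. q x)"
      have bdd: "bdd_below ((\<lambda>q. q x) ` C)" for x
      proof (rule bdd_belowI2[where m = "- p (- x)"])
        fix q assume "q \<in> C"
        with CA have "sublinear q" "q (- x) \<le> p (- x)" by (auto simp: A_def)
        with sublinearD(4)[of q x] show "- p (- x) \<le> q x" by simp
      qed
      have le: "u x \<le> q x" if "q \<in> C" for q x
        unfolding u_def by (rule cINF_lower[OF bdd that])
      have ge: "c \<le> u x" if "\<And>q. q \<in> C \<Longrightarrow> c \<le> q x" for c x
        unfolding u_def by (rule cINF_greatest[OF False that])
      have sub: "sublinear q" if "q \<in> C" for q using that CA by (auto simp: A_def)
      have "sublinear u"
      proof (rule sublinearI)
        fix x y
        have "u (x + y) \<le> a x + b y" if ab: "a \<in> C" "b \<in> C" for a b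
        proof -
          \<comment> \<open>Of two members of the chain the smaller one serves both summands.\<close>
          obtain c where c: "c \<in> C" "c x \<le> a x" "c y \<le> b y"
            using tot[OF ab] ab by (auto simp: P_def)
          with le[of c "x + y"] sublinearD(1)[OF sub, of c x y] show ?thesis by simp
        qed
        then have "u (x + y) - a x \<le> b y" if "a \<in> C" "b \<in> C" for a b
          using that by (simp add: diff_le_eq add.commute)
        then have "u (x + y) - a x \<le> u y" if "a \<in> C" for a
          by (intro ge) (use that in blast)
        then have "u (x + y) - u y \<le> a x" if "a \<in> C" for a
          using that by (simp add: diff_le_eq add.commute)
        then have "u (x + y) - u y \<le> u x" by (intro ge) blast
        then show "u (x + y) \<le> u x + u y" by simp
      next
        have "q 0 = 0" if "q \<in> C" for q using sublinearD(3)[OF sub[OF that]] .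
        then have "u 0 = (INF q\<in>C. 0)" unfolding u_def by (intro INF_cong) auto
        then show "u 0 = 0" using False by simp
      next
        fix r :: real and x assume r: "r > 0"
        have "u (r *\<^sub>R x) / r \<le> u x"
        proof (rule ge)
          fix q assume "q \<in> C"
          then show "u (r *\<^sub>R x) / r \<le> q x"
            using le[of q "r *\<^sub>R x"] sublinearD(2)[OF sub, of q r x] r by (simp add: field_simps)
        qed
        then show "u (r *\<^sub>R x) \<le> r * u x" using r by (simp add: field_simps)
      qed
      moreover have "u x \<le> p x" for x
      proof -
        obtain q where q: "q \<in> C" using False by blast
        then have "q x \<le> p x" using CA by (auto simp: A_def)
        with le[OF q, of x] show ?thesis by simp
      qed
      ultimately show ?thesis using le by (auto simp: A_def P_def)
    qed
  qed
  then obtain m where m: "m \<in> A" "\<And>a. a \<in> A \<Longrightarrow> P m a \<Longrightarrow> a = m" by blast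
  have "linear m"
  proof (rule linear_if_minimal_sublinear)
    show "sublinear m" using m(1) by (simp add: A_def)
    show "q' = m" if "sublinear q'" "\<And>x. q' x \<le> m x" for q'
      using m that by (auto simp: A_def P_def intro: order_trans)
  qed
  with m(1) that show ?thesis by (auto simp: A_def)
qed

text \<open>Sliding the norm along \<open>e\<close> first forces every linear functional below it to attain the norm
  at \<open>e\<close>.\<close>

lemma ex_norming_real_functional:
  fixes e :: "'v::real_normed_vector"
  obtains f where "linear f" "\<And>x. \<bar>f x\<bar> \<le> norm x" "f e = norm e"
proof -
  have sub: "sublinear (norm :: 'v \<Rightarrow> real)"
    by (auto simp: sublinear_def norm_triangle_ineq)
  obtain f where f: "linear f" "\<And>x. f x \<le> slide norm e x"
    using ex_linear_le_sublinear[OF sublinear_slide[OF sub, of e]] by blast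
  have le: "f x \<le> norm x" for x
    using f(2)[of x] slide_le[OF sub, of 0 e x] by simp
  have neg: "f (- x) = - f x" for x using f(1) by (rule linear_neg)
  have "f (- e) \<le> - norm e"
    using f(2)[of "- e"] slide_le[OF sub, of 1 e "- e"] by simp
  with neg le[of e] have "f e = norm e" by simp
  moreover have "\<bar>f x\<bar> \<le> norm x" for x using le[of x] le[of "- x"] neg by simp
  ultimately show ?thesis using f(1) that by blast
qed

section \<open>Scalars and norming functionals\<close>

lemma scalar_embedding:
  obtains h :: "'k::real_or_complex \<Rightarrow> complex"
  where "\<And>a b. h (a + b) = h a + h b" "\<And>r a. h (r *\<^sub>R a) = r *\<^sub>R h a"
    "\<And>a b. h (a * b) = h a * h b" "\<And>a. norm (h a) = norm a"
    "\<And>r. h (of_real r) = of_real r" "inj h" "range h = \<real> \<or> range h = UNIV"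
proof -
  obtain h :: "'k \<Rightarrow> complex" where h: "\<forall>a b. h (a + b) = h a + h b"
    "\<forall>r a. h (r *\<^sub>R a) = r *\<^sub>R h a" "\<forall>a b. h (a * b) = h a * h b" "\<forall>a. norm (h a) = norm a"
    "range h = \<real> \<or> range h = UNIV"
    using ex_embedding_complex by blast
  have "h 1 * h 1 = h 1" using h(3) by (metis mult_1)
  moreover have "h 1 \<noteq> 0" using h(4) by (metis norm_one norm_zero zero_neq_one)
  ultimately have one: "h 1 = 1" by simp
  have "h (of_real r) = of_real r" for r
    using h(2) one by (simp add: of_real_def)
  moreover have "inj h"
  proof (rule injI)
    fix a b assume "h a = h b"
    then have "h (a + (- 1) *\<^sub>R b) = 0" by (simp only: h(1,2)[rule_format]) simp
    then have "norm (a - b) = 0" using h(4)[rule_format, of "a - b"] by simp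
    then show "a = b" by simp
  qed
  ultimately show ?thesis using h that by blast
qed

lemma ex_phase:
  fixes a :: "'k::real_normed_field"
  obtains c where "norm c = 1" "c * a = of_real (norm a)"
proof (cases "a = 0")
  case True
  then show ?thesis using that[of 1] by simp
next
  case False
  then show ?thesis using that[of "of_real (norm a) / a"] by (simp add: norm_divide)
qed

text \<open>Over the complex numbers the real functional \<open>f\<close> is the real part of the complex-linear
  \<open>\<phi> x = f x - \<i> f (\<i> x)\<close>. Multiplying \<open>x\<close> by a phase makes \<open>\<phi> x\<close> real, so the bound on \<open>f\<close>
  carries over to \<open>\<phi>\<close>.\<close>

lemma ex_norming_dual:
  fixes smul :: "'k::real_or_complex \<Rightarrow> 'e::banach \<Rightarrow> 'e"
  assumes "banach_over smul"
  obtains \<phi> where "\<phi> \<in> dual smul" "norm \<phi> \<le> 1" "norm (blinfun_apply \<phi> e) = norm e"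
proof -
  interpret banach_over smul by fact
  obtain h :: "'k \<Rightarrow> complex" where h: "\<And>a b. h (a + b) = h a + h b"
    "\<And>r a. h (r *\<^sub>R a) = r *\<^sub>R h a" "\<And>a b. h (a * b) = h a * h b" "\<And>a. norm (h a) = norm a"
    "\<And>r. h (of_real r) = of_real r" "inj h" "range h = \<real> \<or> range h = UNIV"
    by (rule scalar_embedding, rule that)
  obtain f :: "'e \<Rightarrow> real" where f: "linear f" "\<And>x. \<bar>f x\<bar> \<le> norm x" "f e = norm e"
    using ex_norming_real_functional by blast
  have real_comm: "smul a (r *\<^sub>R x) = r *\<^sub>R smul a x" for a r x
    using scale_left_commute[of a "of_real r" x] by (simp only: smul_of_real)
  have hinj: "h a = h b \<Longrightarrow> a = b" for a b using h(6) by (auto dest: injD)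
  have "\<exists>\<phi>. (\<forall>x y. \<phi> (x + y) = \<phi> x + \<phi> y) \<and> (\<forall>a x. \<phi> (smul a x) = a * \<phi> x) \<and>
      (\<forall>x. Re (h (\<phi> x)) = f x)"
    using h(7)
  proof
    assume "range h = \<real>"
    have re: "\<exists>r. a = of_real r" for a :: 'k
    proof -
      have "h a \<in> \<real>" using \<open>range h = \<real>\<close> by blast
      then obtain r where "h a = of_real r" by (auto elim: Reals_cases)
      then have "a = of_real r" by (intro hinj) (simp add: h(5))
      then show ?thesis ..
    qed
    have "(of_real (f (smul a x)) :: 'k) = a * of_real (f x)" for a x
      using re[of a] by (auto simp: smul_of_real linear_scale[OF f(1)])
    then show ?thesis
      by (intro exI[of _ "\<lambda>x. of_real (f x)"]) (simp add: linear_add[OF f(1)] h(5))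
  next
    assume "range h = UNIV"
    then obtain j where j: "h j = \<i>" by (metis surj_def)
    have jj: "j * j = of_real (- 1)" by (rule hinj) (simp only: h(3,5) j, simp)
    have dec: "\<exists>r s. a = of_real r + j * of_real s" for a
    proof (intro exI hinj)
      show "h a = h (of_real (Re (h a)) + j * of_real (Im (h a)))"
        unfolding h(1,3,5) j by (rule complex_eq)
    qed
    define \<phi> where "\<phi> = (\<lambda>x. of_real (f x) - j * of_real (f (smul j x)))"
    have add: "\<phi> (x + y) = \<phi> x + \<phi> y" for x y
      by (simp add: \<phi>_def linear_add[OF f(1)] scale_right_distrib algebra_simps)
    have real: "\<phi> (r *\<^sub>R x) = of_real r * \<phi> x" for r x
      by (simp add: \<phi>_def linear_scale[OF f(1)] real_comm algebra_simps)
    have img: "\<phi> (smul j x) = j * \<phi> x" for x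
    proof -
      have "smul j (smul j x) = - x"
        by (simp add: jj smul_of_real del: of_real_minus)
      then have "\<phi> (smul j x) = of_real (f (smul j x)) + j * of_real (f x)"
        by (simp add: \<phi>_def linear_neg[OF f(1)])
      also have "\<dots> = j * of_real (f x) - (j * j) * of_real (f (smul j x))"
        by (simp add: jj)
      also have "\<dots> = j * \<phi> x" by (simp add: \<phi>_def algebra_simps)
      finally show ?thesis .
    qed
    have "\<phi> (smul a x) = a * \<phi> x" for a x
    proof -
      obtain r s where a: "a = of_real r + j * of_real s" using dec by blast
      have "smul a x = r *\<^sub>R x + s *\<^sub>R smul j x"
        by (simp add: a scale_left_distrib smul_of_real real_comm flip: scale_scale)
      then show ?thesis by (simp add: add real img a algebra_simps)
    qed
    moreover have "Re (h (\<phi> x)) = f x" for x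
    proof -
      have "\<phi> x = of_real (f x) + j * of_real (- f (smul j x))" by (simp add: \<phi>_def)
      then show ?thesis by (simp only: h(1,3,5) j) simp
    qed
    ultimately show ?thesis using add by blast
  qed
  then obtain \<phi> where \<phi>: "\<And>x y. \<phi> (x + y) = \<phi> x + \<phi> y" "\<And>a x. \<phi> (smul a x) = a * \<phi> x"
    "\<And>x. Re (h (\<phi> x)) = f x" by blast
  have bound: "norm (\<phi> x) \<le> norm x" for x
  proof -
    obtain c where c: "norm c = 1" "c * \<phi> x = of_real (norm (\<phi> x))" using ex_phase by blast
    have "norm (\<phi> x) = Re (h (\<phi> (smul c x)))" by (simp add: \<phi>(2) c(2) h(5))
    also have "\<dots> \<le> norm (smul c x)" using f(2)[of "smul c x"] by (simp add: \<phi>(3))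
    finally show ?thesis by (simp add: norm_smul c(1))
  qed
  have scaleR: "\<phi> (r *\<^sub>R x) = r *\<^sub>R \<phi> x" for r x
    using \<phi>(2)[of "of_real r" x] by (simp add: smul_of_real scaleR_conv_of_real)
  have bl: "bounded_linear \<phi>"
    by (rule bounded_linear_intro[where K = 1]) (use \<phi>(1) scaleR bound in auto)
  have app: "blinfun_apply (Blinfun \<phi>) = \<phi>" by (rule bounded_linear_Blinfun_apply[OF bl])
  have "norm e \<le> norm (\<phi> e)"
    using complex_Re_le_cmod[of "h (\<phi> e)"] \<phi>(3)[of e] f(3) h(4) by simp
  show ?thesis
  proof (rule that)
    show "Blinfun \<phi> \<in> dual smul" by (simp add: dual_def app \<phi>(2))
    show "norm (Blinfun \<phi>) \<le> 1" by (rule norm_blinfun_bound) (use bound app in auto)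
    show "norm (blinfun_apply (Blinfun \<phi>) e) = norm e"
      using \<open>norm e \<le> norm (\<phi> e)\<close> bound[of e] by (simp add: app)
  qed
qed

section \<open>Separation by finitely many coordinates\<close>

text \<open>The separation of a point \<open>t\<close> from an absolutely convex bounded set \<open>K\<close> in the finite-dimensional
  space of the coordinates in \<open>J\<close>. The separating functional is the inner product with \<open>t - z\<close>,
  where \<open>z \<in> K\<close> almost minimizes the Euclidean distance to \<open>t\<close>. Since \<open>K\<close> need not be closed,
  there may be no nearest point; but moving from \<open>z\<close> towards any \<open>y \<in> K\<close> by a fixed fraction \<open>s\<close>
  of the way cannot decrease the squared distance by more than the defect of \<open>z\<close>, and boundedness
  makes the second-order term small uniformly in \<open>y\<close>.\<close>

lemma separation_finite:
  fixes K :: "('i \<Rightarrow> 'k::real_or_complex) set" and t :: "'i \<Rightarrow> 'k"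
  assumes ne: "K \<noteq> {}"
    and abs_conv: "\<And>y z a b. y \<in> K \<Longrightarrow> z \<in> K \<Longrightarrow> norm a + norm b \<le> 1 \<Longrightarrow>
      (\<lambda>j. a * y j + b * z j) \<in> K"
    and bounded: "\<And>z j. z \<in> K \<Longrightarrow> j \<in> J \<Longrightarrow> norm (z j) \<le> M"
    and \<epsilon>: "\<epsilon> > 0" and far: "\<And>z. z \<in> K \<Longrightarrow> \<exists>j\<in>J. norm (z j - t j) \<ge> \<epsilon>"
    and J: "finite J"
  obtains c \<delta> where "\<delta> > 0"
    "\<And>z. z \<in> K \<Longrightarrow> norm (\<Sum>j\<in>J. c j * z j) + \<delta> \<le> norm (\<Sum>j\<in>J. c j * t j)"
proof -
  obtain h :: "'k \<Rightarrow> complex" where h: "\<And>a b. h (a + b) = h a + h b"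
    "\<And>r a. h (r *\<^sub>R a) = r *\<^sub>R h a" "\<And>a b. h (a * b) = h a * h b" "\<And>a. norm (h a) = norm a"
    "\<And>r. h (of_real r) = of_real r" "inj h" "range h = \<real> \<or> range h = UNIV"
    by (rule scalar_embedding, rule that)
  have h_diff: "h (a - b) = h a - h b" for a b
    using h(1)[of "a - b" b] by simp
  have h_sum: "h (sum g A) = (\<Sum>j\<in>A. h (g j))" for g :: "'i \<Rightarrow> 'k" and A
    using h(1) h(5)[of 0] by (induction A rule: infinite_finite_induct) auto
  have "\<exists>b. h b = cnj (h a)" for a
    using h(7)
  proof
    assume "range h = \<real>"
    then have "h a \<in> \<real>" by blast
    then have "h a = cnj (h a)" by (simp add: Reals_cnj_iff)
    then show ?thesis by blast
  next
    assume "range h = UNIV"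
    then show ?thesis by (metis surj_def)
  qed
  then obtain conj where conj: "\<And>a. h (conj a) = cnj (h a)" by metis
  have cmod_expand: "(cmod (a - s *\<^sub>R b))\<^sup>2 =
      (cmod a)\<^sup>2 - 2 * s * Re (cnj a * b) + s\<^sup>2 * (cmod b)\<^sup>2" for a b s
    unfolding cmod_power2 by (simp add: power2_eq_square algebra_simps)
  define q where "q = (\<lambda>z. \<Sum>j\<in>J. (norm (t j - z j))\<^sup>2)"
  define m where "m = Inf (q ` K)"
  define D where "D = (\<Sum>j\<in>J. (2 * M)\<^sup>2)"
  have D: "D \<ge> 0" by (simp add: D_def sum_nonneg)
  have bdd: "bdd_below (q ` K)"
    by (rule bdd_belowI2[where m = 0]) (simp add: q_def sum_nonneg)
  have m_le: "m \<le> q z" if "z \<in> K" for z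
    unfolding m_def by (rule cINF_lower[OF bdd that])
  have "\<epsilon>\<^sup>2 \<le> m"
    unfolding m_def
  proof (rule cINF_greatest[OF ne])
    fix z assume "z \<in> K"
    then obtain j where j: "j \<in> J" "norm (z j - t j) \<ge> \<epsilon>" using far by blast
    then have "\<epsilon>\<^sup>2 \<le> (norm (t j - z j))\<^sup>2"
      using \<epsilon> by (intro power_mono) (auto simp: norm_minus_commute)
    also have "\<dots> \<le> q z" unfolding q_def by (rule member_le_sum) (use j J in auto)
    finally show "\<epsilon>\<^sup>2 \<le> q z" .
  qed
  with \<epsilon> have m: "m > 0" by (smt (verit) zero_less_power)
  \<comment> \<open>The step length makes the second-order term \<open>s * D\<close> at most \<open>m / 2\<close>; the defect \<open>s * m\<close> of \<open>z\<close>
    then contributes at most \<open>m\<close> after division by \<open>s\<close>, so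
    \<open>2 * R \<le> 3 / 2 * m\<close> below, which leaves a gap of \<open>m / 4\<close>.\<close>
  define s where "s = min 1 (m / (2 * (D + 1)))"
  have s: "0 < s" "s \<le> 1" using m D by (auto simp: s_def)
  have "s * D \<le> m / (2 * (D + 1)) * D" using D by (intro mult_right_mono) (auto simp: s_def)
  also have "\<dots> \<le> m / 2" using m D by (simp add: field_simps)
  finally have sD: "s * D \<le> m / 2" .
  obtain z where z: "z \<in> K" "q z < m + s * m"
    using cINF_less_iff[OF ne bdd, of "m + s * m"] s m unfolding m_def[symmetric] by auto
  define c where "c = (\<lambda>j. conj (t j - z j))"
  define L where "L = (\<lambda>y. \<Sum>j\<in>J. c j * y j)"
  have L_diff: "L y - L y' = (\<Sum>j\<in>J. c j * (y j - y' j))" for y y'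
    by (simp add: L_def sum_subtractf algebra_simps)
  have near: "Re (h (L y)) - Re (h (L z)) \<le> 3 / 4 * m" if y: "y \<in> K" for y
  proof -
    define R where "R = Re (h (L y)) - Re (h (L z))"
    define y' where "y' = (\<lambda>j. of_real (1 - s) * z j + of_real s * y j)"
    have "norm (of_real (1 - s) :: 'k) + norm (of_real s :: 'k) \<le> 1"
      unfolding norm_of_real using s by simp
    then have "y' \<in> K" unfolding y'_def by (rule abs_conv[OF z(1) y])
    have expand: "(norm (t j - y' j))\<^sup>2 = (norm (t j - z j))\<^sup>2
        - 2 * s * Re (h (c j * (y j - z j))) + s\<^sup>2 * (norm (y j - z j))\<^sup>2" for j
    proof -
      have "t j - y' j = (t j - z j) - s *\<^sub>R (y j - z j)"
        by (simp add: y'_def scaleR_conv_of_real algebra_simps)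
      then have "h (t j - y' j) = h (t j - z j) - s *\<^sub>R h (y j - z j)"
        by (simp only: h_diff h(2))
      then have "(norm (h (t j - y' j)))\<^sup>2 = (norm (h (t j - z j)))\<^sup>2
          - 2 * s * Re (cnj (h (t j - z j)) * h (y j - z j)) + s\<^sup>2 * (norm (h (y j - z j)))\<^sup>2"
        by (simp only: cmod_expand)
      then show ?thesis by (simp only: h(3,4) c_def conj)
    qed
    have "(norm (y j - z j))\<^sup>2 \<le> (2 * M)\<^sup>2" if "j \<in> J" for j
      using norm_triangle_ineq4[of "y j" "z j"] bounded[OF y that] bounded[OF z(1) that]
      by (intro power_mono) auto
    then have "(\<Sum>j\<in>J. (norm (y j - z j))\<^sup>2) \<le> D" unfolding D_def by (rule sum_mono)
    then have "s\<^sup>2 * (\<Sum>j\<in>J. (norm (y j - z j))\<^sup>2) \<le> s\<^sup>2 * D" by (intro mult_left_mono) auto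
    moreover have "q y' = q z - 2 * s * R + s\<^sup>2 * (\<Sum>j\<in>J. (norm (y j - z j))\<^sup>2)"
    proof -
      have "R = (\<Sum>j\<in>J. Re (h (c j * (y j - z j))))"
        unfolding R_def by (simp flip: minus_complex.sel h_diff add: L_diff h_sum)
      then show ?thesis
        by (simp add: q_def expand sum.distrib sum_subtractf sum_distrib_left)
    qed
    ultimately have "s * (2 * R) \<le> s * (m + s * D)"
      using m_le[OF \<open>y' \<in> K\<close>] z(2) by (simp add: power2_eq_square algebra_simps)
    then have "2 * R \<le> m + s * D" using s(1) by simp
    with sD show ?thesis unfolding R_def[symmetric] by simp
  qed
  have "Re (h (L t)) - Re (h (L z)) = q z"
  proof -
    have square: "cnj (h a) * h a = of_real ((norm a)\<^sup>2)" for a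
      using complex_norm_square[of "h a"] by (simp add: h(4) mult.commute)
    have "h (L t) - h (L z) = (\<Sum>j\<in>J. cnj (h (t j - z j)) * h (t j - z j))"
      by (simp add: L_diff h_sum h(3) c_def conj flip: h_diff)
    also have "\<dots> = of_real (q z)"
      by (simp only: square q_def of_real_sum)
    finally show ?thesis by (metis Re_complex_of_real minus_complex.sel(1))
  qed
  with m_le[OF z(1)] have far_t: "Re (h (L z)) + m \<le> norm (L t)"
    using complex_Re_le_cmod[of "h (L t)"] by (simp add: h(4))
  show ?thesis
  proof (rule that)
    show "m / 4 > 0" using m by simp
    fix y assume y: "y \<in> K"
    \<comment> \<open>Rotating \<open>y\<close> turns the bound on the real part into one on the modulus.\<close>
    obtain a where a: "norm a = 1" "a * L y = of_real (norm (L y))" using ex_phase by blast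
    have "(\<lambda>j. a * y j + 0 * y j) \<in> K" by (rule abs_conv[OF y y]) (simp add: a(1))
    from near[OF this] have "Re (h (L (\<lambda>j. a * y j))) - Re (h (L z)) \<le> 3 / 4 * m" by simp
    moreover have "L (\<lambda>j. a * y j) = a * L y"
      by (simp add: L_def sum_distrib_left algebra_simps)
    ultimately have "norm (L y) - Re (h (L z)) \<le> 3 / 4 * m" by (simp add: a(2) h(5))
    with far_t show "norm (\<Sum>j\<in>J. c j * y j) + m / 4 \<le> norm (\<Sum>j\<in>J. c j * t j)"
      unfolding L_def by simp
  qed
qed

section \<open>Lipschitz maps and the Lipschitz tensor product\<close>

lemma Lip_le:
  assumes "C-lipschitz_on UNIV f"
  shows "Lip f \<le> C"
  unfolding Lip_def
  by (rule cInf_lower) (use assms in \<open>auto intro!: bdd_belowI[of _ 0] dest: lipschitz_on_nonneg\<close>)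

lemma Lip_nonneg:
  assumes "f \<in> Lip0 x0 F"
  shows "0 \<le> Lip f"
  unfolding Lip_def
  by (rule cInf_greatest) (use assms in \<open>auto simp: Lip0_def dest: lipschitz_on_nonneg\<close>)

lemma norm_diff_le_Lip:
  assumes f: "f \<in> Lip0 x0 F"
  shows "norm (f x - f y) \<le> Lip f * dist x y"
proof (cases "x = y")
  case False
  have "norm (f x - f y) / dist x y \<le> Lip f"
    unfolding Lip_def
  proof (rule cInf_greatest)
    show "{C. C-lipschitz_on UNIV f} \<noteq> {}" using f by (auto simp: Lip0_def)
    fix C assume "C \<in> {C. C-lipschitz_on UNIV f}"
    then have "dist (f x) (f y) \<le> C * dist x y" by (auto intro: lipschitz_onD)
    then show "norm (f x - f y) / dist x y \<le> C" using False by (simp add: dist_norm divide_le_eq)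
  qed
  then show ?thesis using False by (simp add: divide_le_eq)
qed simp

lemma elem_tensor_apply:
  "f \<in> Lip0 x0 (dual smul) \<Longrightarrow>
    elem_tensor x0 smul x y e f = blinfun_apply (f x) e - blinfun_apply (f y) e"
  by (simp add: elem_tensor_def blinfun.diff_left)

interpretation functional: vector_space functional_scale
  by (rule vector_space_functional_scale)

interpretation op: vector_space op_scale
  by (rule vector_space_op_scale)

lemma sum_fun_apply: "(\<Sum>i\<in>A. u i) f = (\<Sum>i\<in>A. u i f)"
  by (induction A rule: infinite_finite_induct) auto

lemma lip_tensor_subspace: "functional.subspace (lip_tensor x0 smul)"
  unfolding lip_tensor_def by (rule functional.subspace_span)

lemma elem_tensor_in_lip_tensor: "elem_tensor x0 smul x y e \<in> lip_tensor x0 smul"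
  unfolding lip_tensor_def by (rule functional.span_base) blast

lemma sum_elem_tensor_apply:
  "f \<in> Lip0 x0 (dual smul) \<Longrightarrow>
    (\<Sum>i\<in>I. elem_tensor x0 smul (x i) (y i) (e i)) f = (\<Sum>i\<in>I. blinfun_apply (f (x i) - f (y i)) (e i))"
  by (simp add: sum_fun_apply elem_tensor_def)

lemma sum_elem_tensor_in_lip_tensor:
  "(\<Sum>i\<in>I. elem_tensor x0 smul (x i) (y i) (e i)) \<in> lip_tensor x0 smul"
  by (intro functional.subspace_sum lip_tensor_subspace elem_tensor_in_lip_tensor)

text \<open>A normal form: grouping the terms of a tensor by the points at which \<open>f\<close> is evaluated, with the
  scalars absorbed into \<open>E\<close>, makes it a finite sum of evaluations at distinct points. The base
  point is dropped since \<open>f x0 = 0\<close>; this makes the coefficients \<open>v p\<close> detectable by test maps.\<close>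

lemma lip_tensor_eval:
  fixes smul :: "'k::real_or_complex \<Rightarrow> 'e::banach \<Rightarrow> 'e" and x0 :: "'x::metric_space"
  assumes "u \<in> lip_tensor x0 smul"
  obtains P v where "finite P" "x0 \<notin> P"
    "\<And>f. f \<in> Lip0 x0 (dual smul) \<Longrightarrow> u f = (\<Sum>p\<in>P. blinfun_apply (f p) (v p))"
    "\<And>f. f \<notin> Lip0 x0 (dual smul) \<Longrightarrow> u f = 0"
proof -
  let ?L = "Lip0 x0 (dual smul)"
  have "\<exists>P v. finite P \<and> (\<forall>f. u f = (if f \<in> ?L then \<Sum>p\<in>P. blinfun_apply (f p) (v p) else 0))"
    using assms unfolding lip_tensor_def
  proof (induction u rule: functional.span_induct_alt)
    case base
    then show ?case by (intro exI[of _ "{}"]) auto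
  next
    case (step c w u)
    then obtain a b e where w: "w = elem_tensor x0 smul a b e" by blast
    from step.IH obtain P v where P: "finite P"
      and u: "\<And>f. u f = (if f \<in> ?L then \<Sum>p\<in>P. blinfun_apply (f p) (v p) else 0)" by blast
    define Q where "Q = insert a (insert b P)"
    define v' where "v' = (\<lambda>p. (if p \<in> P then v p else 0)
      + ((if p = a then smul c e else 0) - (if p = b then smul c e else 0)))"
    have Q: "finite Q" using P by (simp add: Q_def)
    have "(functional_scale c w + u) f = (\<Sum>p\<in>Q. blinfun_apply (f p) (v' p))" if f: "f \<in> ?L" for f
    proof -
      have lin: "blinfun_apply (f p) (smul c e) = c * blinfun_apply (f p) e" for p
        using f by (auto simp: Lip0_def dual_def)
      have if_apply: "blinfun_apply (f p) (if R then d else 0) = (if R then blinfun_apply (f p) d else 0)"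
        for p R d by simp
      have "(\<Sum>p\<in>Q. blinfun_apply (f p) (v' p)) =
          (\<Sum>p\<in>Q. if p \<in> P then blinfun_apply (f p) (v p) else 0)
          + (blinfun_apply (f a) (smul c e) - blinfun_apply (f b) (smul c e))"
        using Q unfolding v'_def blinfun.add_right blinfun.diff_right if_apply
          sum.distrib sum_subtractf
        by (simp add: sum.delta Q_def)
      also have "(\<Sum>p\<in>Q. if p \<in> P then blinfun_apply (f p) (v p) else 0)
          = (\<Sum>p\<in>P. blinfun_apply (f p) (v p))"
        using Q by (intro sum.mono_neutral_cong_right) (auto simp: Q_def)
      finally show ?thesis
        using f by (simp add: w u elem_tensor_apply functional_scale_def lin algebra_simps)
    qed
    moreover have "(functional_scale c w + u) f = 0" if "f \<notin> ?L" for f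
      using that by (simp add: w u elem_tensor_def functional_scale_def)
    ultimately show ?case using Q by (intro exI[of _ Q] exI[of _ v']) simp
  qed
  then obtain P v where P: "finite P"
    and u: "\<And>f. u f = (if f \<in> ?L then \<Sum>p\<in>P. blinfun_apply (f p) (v p) else 0)" by blast
  have "u f = (\<Sum>p\<in>P - {x0}. blinfun_apply (f p) (v p))" if f: "f \<in> ?L" for f
  proof -
    have "f x0 = 0" using f by (simp add: Lip0_def)
    then have "(\<Sum>p\<in>P. blinfun_apply (f p) (v p)) = (\<Sum>p\<in>P - {x0}. blinfun_apply (f p) (v p))"
      using P by (intro sum.mono_neutral_right) auto
    with u f show ?thesis by simp
  qed
  with P u show ?thesis by (intro that[of "P - {x0}" v]) auto
qed

lemma lip_tensor_eq_sum:
  assumes "u \<in> lip_tensor x0 smul"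
  obtains n :: nat and x y e where "u = (\<Sum>i<n. elem_tensor x0 smul (x i) (y i) (e i))"
proof -
  from assms obtain P v where P: "finite P"
    and u: "\<And>f. f \<in> Lip0 x0 (dual smul) \<Longrightarrow> u f = (\<Sum>p\<in>P. blinfun_apply (f p) (v p))"
      "\<And>f. f \<notin> Lip0 x0 (dual smul) \<Longrightarrow> u f = 0"
    by (rule lip_tensor_eval) (rule that)
  obtain b where b: "bij_betw b {..<card P} P"
    using ex_bij_betw_nat_finite[OF P] by (auto simp: atLeast0LessThan)
  have "u = (\<Sum>p\<in>P. elem_tensor x0 smul p x0 (v p))"
  proof
    fix f
    show "u f = (\<Sum>p\<in>P. elem_tensor x0 smul p x0 (v p)) f"
    proof (cases "f \<in> Lip0 x0 (dual smul)")
      case True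
      then show ?thesis by (simp add: u sum_elem_tensor_apply) (simp add: Lip0_def)
    next
      case False
      then show ?thesis by (simp add: u sum_fun_apply elem_tensor_def)
    qed
  qed
  also have "\<dots> = (\<Sum>i<card P. elem_tensor x0 smul (b i) x0 (v (b i)))"
    by (rule sum.reindex_bij_betw[OF b, symmetric])
  finally show ?thesis by (rule that)
qed

lemma lip_tensor_bounded:
  assumes "u \<in> lip_tensor x0 smul"
  obtains K where "\<And>f. f \<in> Lip0 x0 (dual smul) \<Longrightarrow> norm (u f) \<le> K * Lip f"
proof -
  from assms obtain P v where
    u: "\<And>f. f \<in> Lip0 x0 (dual smul) \<Longrightarrow> u f = (\<Sum>p\<in>P. blinfun_apply (f p) (v p))"
    by (rule lip_tensor_eval) (rule that)
  have "norm (u f) \<le> (\<Sum>p\<in>P. dist p x0 * norm (v p)) * Lip f" if f: "f \<in> Lip0 x0 (dual smul)" for f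
  proof -
    have "norm (blinfun_apply (f p) (v p)) \<le> dist p x0 * norm (v p) * Lip f" for p
    proof -
      have "norm (f p) \<le> Lip f * dist p x0"
        using norm_diff_le_Lip[OF f, of p x0] f by (simp add: Lip0_def)
      then have "norm (f p) * norm (v p) \<le> Lip f * dist p x0 * norm (v p)"
        by (rule mult_right_mono) simp
      with norm_blinfun[of "f p" "v p"] show ?thesis by (simp add: mult_ac)
    qed
    then show ?thesis
      unfolding u[OF f] sum_distrib_right by (intro sum_norm_le)
  qed
  then show ?thesis by (rule that)
qed

section \<open>The norm that the operator space induces on the tensor product\<close>

text \<open>The dual norm: each tensor is viewed as a linear functional on \<open>B\<close>. When \<open>B\<close> is the space
  \<open>Lip_alpha\<close> of some norm \<open>\<alpha>\<close>, it is the dual of the tensor product with \<open>\<alpha>\<close>, and the norm of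
  a normed space is recovered from its dual unit ball in this way, which leaves no other choice.\<close>

definition predual_norm :: "'f set \<Rightarrow> ('f \<Rightarrow> real) \<Rightarrow> ('f \<Rightarrow> 'k::real_normed_field) \<Rightarrow> real" where
  "predual_norm B normB u = (SUP f\<in>{f\<in>B. normB f \<le> 1}. norm (u f))"

context
  fixes x0 :: "'x::metric_space"
    and smul :: "'k::real_or_complex \<Rightarrow> 'e::banach \<Rightarrow> 'e"
    and B :: "('x \<Rightarrow> ('e \<Rightarrow>\<^sub>L 'k)) set"
    and normB :: "('x \<Rightarrow> ('e \<Rightarrow>\<^sub>L 'k)) \<Rightarrow> real"
  assumes smul: "banach_over smul"
    and lob: "lip_operator_banach x0 smul B normB"
begin

lemma B_subspace: "op.subspace B"
  using lob by (simp add: lip_operator_banach_def)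

lemma B_Lip0: "f \<in> B \<Longrightarrow> f \<in> Lip0 x0 (dual smul)"
  using lob by (auto simp: lip_operator_banach_def)

lemma normB_nonneg: "f \<in> B \<Longrightarrow> 0 \<le> normB f"
  and normB_eq_0: "f \<in> B \<Longrightarrow> normB f = 0 \<longleftrightarrow> f = 0"
  and normB_triangle: "f \<in> B \<Longrightarrow> g \<in> B \<Longrightarrow> normB (f + g) \<le> normB f + normB g"
  and normB_scale: "f \<in> B \<Longrightarrow> normB (op_scale a f) = norm a * normB f"
  using lob by (auto simp: lip_operator_banach_def norm_on_def)

lemma Lip_le_normB: "f \<in> B \<Longrightarrow> Lip f \<le> normB f"
  using lob by (auto simp: lip_operator_banach_def)

lemma rank_one:
  assumes "g \<in> Lip0 x0 (UNIV :: 'k set)" "\<phi> \<in> dual smul"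
  shows "(\<lambda>x. dual_scale (g x) \<phi>) \<in> B" "normB (\<lambda>x. dual_scale (g x) \<phi>) = Lip g * norm \<phi>"
  using assms lob by (auto simp: lip_operator_banach_def)

lemma zero_in_B: "0 \<in> B" and normB_zero: "normB 0 = 0"
  using op.subspace_0[OF B_subspace] normB_eq_0 by auto

lemma lip_tensor_linear_on_B:
  assumes u: "u \<in> lip_tensor x0 smul" and f: "f \<in> B" and g: "g \<in> B"
  shows "u (op_scale a f + op_scale b g) = a * u f + b * u g"
    and "u (op_scale a f) = a * u f" and "u 0 = 0"
proof -
  from u obtain P v where
    ev: "\<And>f. f \<in> Lip0 x0 (dual smul) \<Longrightarrow> u f = (\<Sum>p\<in>P. blinfun_apply (f p) (v p))"
    by (rule lip_tensor_eval) (rule that)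
  have "op_scale a f + op_scale b g \<in> B" "op_scale a f \<in> B"
    using f g by (auto intro!: op.subspace_add op.subspace_scale B_subspace)
  then show "u (op_scale a f + op_scale b g) = a * u f + b * u g" "u (op_scale a f) = a * u f" "u 0 = 0"
    using f g zero_in_B
    by (auto simp: ev B_Lip0 op_scale_def dual_scale_apply blinfun.add_left sum.distrib sum_distrib_left)
qed

abbreviation \<alpha>\<^sub>B :: "(('x \<Rightarrow> ('e \<Rightarrow>\<^sub>L 'k)) \<Rightarrow> 'k) \<Rightarrow> real" where
  "\<alpha>\<^sub>B \<equiv> predual_norm B normB"

lemma norm_le_predual_norm_unit:
  assumes u: "u \<in> lip_tensor x0 smul" and f: "f \<in> B" "normB f \<le> 1"
  shows "norm (u f) \<le> \<alpha>\<^sub>B u"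
proof -
  obtain K where K: "\<And>f. f \<in> Lip0 x0 (dual smul) \<Longrightarrow> norm (u f) \<le> K * Lip f"
    by (rule lip_tensor_bounded[OF u], rule that)
  have "norm (u g) \<le> \<bar>K\<bar>" if "g \<in> B" "normB g \<le> 1" for g
  proof -
    have "Lip g \<in> {0..1}" using Lip_le_normB[OF that(1)] that(2) Lip_nonneg[OF B_Lip0[OF that(1)]] by simp
    then have "K * Lip g \<le> \<bar>K\<bar> * 1" by (intro mult_mono) auto
    with K[OF B_Lip0[OF that(1)]] show ?thesis by simp
  qed
  then have "bdd_above ((\<lambda>f. norm (u f)) ` {f \<in> B. normB f \<le> 1})"
    by (intro bdd_aboveI2[where M = "\<bar>K\<bar>"]) simp
  then show ?thesis unfolding predual_norm_def by (rule cSUP_upper2) (use f in auto)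
qed

lemma predual_norm_le:
  assumes "\<And>f. f \<in> B \<Longrightarrow> normB f \<le> 1 \<Longrightarrow> norm (u f) \<le> c"
  shows "\<alpha>\<^sub>B u \<le> c"
  unfolding predual_norm_def
  by (rule cSUP_least) (use assms zero_in_B normB_zero in \<open>auto intro!: exI[of _ 0]\<close>)

lemma norm_le_predual_norm:
  assumes u: "u \<in> lip_tensor x0 smul" and f: "f \<in> B"
  shows "norm (u f) \<le> normB f * \<alpha>\<^sub>B u"
proof (cases "f = 0")
  case True
  then show ?thesis using lip_tensor_linear_on_B(3)[OF u f f] normB_zero by simp
next
  case False
  then have pos: "normB f > 0" using normB_nonneg[OF f] normB_eq_0[OF f] by simp
  let ?c = "of_real (inverse (normB f)) :: 'k"
  have c: "norm ?c = inverse (normB f)" unfolding norm_of_real using pos by simp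
  have "norm (u (op_scale ?c f)) \<le> \<alpha>\<^sub>B u"
    by (rule norm_le_predual_norm_unit[OF u])
      (use f pos in \<open>simp_all add: normB_scale c op.subspace_scale[OF B_subspace] del: of_real_inverse\<close>)
  then have "inverse (normB f) * norm (u f) \<le> \<alpha>\<^sub>B u"
    by (simp only: lip_tensor_linear_on_B(2)[OF u f f] norm_mult c)
  then show ?thesis using pos by (simp add: field_simps)
qed

lemma predual_norm_nonneg: "u \<in> lip_tensor x0 smul \<Longrightarrow> 0 \<le> \<alpha>\<^sub>B u"
  using norm_le_predual_norm_unit[OF _ zero_in_B, of u] normB_zero norm_ge_zero[of "u 0"] by linarith

text \<open>Definiteness of the norm. Although \<open>B\<close> may be much smaller than \<open>Lip0\<close>, its rank-one maps
  \<open>x \<mapsto> g x \<cdot> \<phi>\<close> suffice: \<open>g\<close> isolates one point \<open>p\<close> of the normal form, and \<open>\<phi>\<close> detects the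
  coefficient \<open>v p\<close>.\<close>

lemma lip_tensor_eq_0_if_vanishing_on_B:
  assumes u: "u \<in> lip_tensor x0 smul" and zero: "\<And>f. f \<in> B \<Longrightarrow> u f = 0"
  shows "u = 0"
proof -
  from u obtain P v where P: "finite P" "x0 \<notin> P"
    and ev: "\<And>f. f \<in> Lip0 x0 (dual smul) \<Longrightarrow> u f = (\<Sum>p\<in>P. blinfun_apply (f p) (v p))"
    and out: "\<And>f. f \<notin> Lip0 x0 (dual smul) \<Longrightarrow> u f = 0"
    by (rule lip_tensor_eval) (rule that)
  have "v p = 0" if p: "p \<in> P" for p
  proof -
    obtain \<phi> where \<phi>: "\<phi> \<in> dual smul" "norm (blinfun_apply \<phi> (v p)) = norm (v p)"
      using ex_norming_dual[OF smul] by metis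
    \<comment> \<open>A bump function that is 1 at \<open>p\<close> and vanishes at the base point and the rest of \<open>P\<close>.\<close>
    define d where "d = Min (dist p ` (insert x0 P - {p}))"
    have fin: "finite (insert x0 P - {p})" "insert x0 P - {p} \<noteq> {}" using P p by auto
    have d: "d > 0" unfolding d_def using fin by (subst Min_gr_iff) auto
    have d_le: "d \<le> dist p r" if "r \<in> insert x0 P" "r \<noteq> p" for r
      unfolding d_def by (rule Min_le) (use fin that in auto)
    define b where "b = (\<lambda>z. max 0 (1 - dist p z / d))"
    define g where "g = (\<lambda>z. of_real (b z) :: 'k)"
    have "\<bar>b y - b z\<bar> \<le> 1 / d * dist y z" for y z
    proof -
      have "\<bar>b y - b z\<bar> \<le> \<bar>dist p y / d - dist p z / d\<bar>" unfolding b_def by linarith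
      also have "\<dots> = \<bar>dist p y - dist p z\<bar> / d" using d by (simp flip: diff_divide_distrib)
      also have "\<dots> \<le> dist y z / d"
        using d abs_dist_diff_le[of y p z] dist_commute[of y p] by (intro divide_right_mono) auto
      finally show ?thesis by simp
    qed
    then have "(1 / d)-lipschitz_on UNIV g"
      using d by (intro lipschitz_onI)
        (simp_all only: g_def dist_norm norm_of_real zero_le_divide_1_iff less_imp_le flip: of_real_diff)
    moreover have g0: "g r = 0" if "r \<in> insert x0 P" "r \<noteq> p" for r
      using d_le[OF that] d by (simp add: g_def b_def)
    moreover have "x0 \<noteq> p" using P p by auto
    ultimately have "g \<in> Lip0 x0 UNIV" by (auto simp: Lip0_def)
    from rank_one(1)[OF this \<phi>(1)] have "(\<lambda>x. dual_scale (g x) \<phi>) \<in> B" .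
    from zero[OF this] ev[OF B_Lip0[OF this]]
    have "0 = (\<Sum>r\<in>P. g r * blinfun_apply \<phi> (v r))" by (simp add: dual_scale_apply)
    also have "\<dots> = g p * blinfun_apply \<phi> (v p)"
      using P p g0 by (subst sum.remove[OF P(1) p]) auto
    finally show "v p = 0" using \<phi>(2) by (simp add: g_def b_def)
  qed
  then have "u f = 0" for f
    by (cases "f \<in> Lip0 x0 (dual smul)") (simp_all add: ev out)
  then show ?thesis by (simp add: fun_eq_iff)
qed

text \<open>The lower bound is attained at the rank-one map of \<open>z \<mapsto> dist z y\<close>, shifted to vanish at the base
  point, and of a functional of norm at most 1 that norms \<open>e\<close>.\<close>

lemma predual_norm_elem_tensor: "\<alpha>\<^sub>B (elem_tensor x0 smul x y e) = dist x y * norm e"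
proof (rule antisym)
  show "\<alpha>\<^sub>B (elem_tensor x0 smul x y e) \<le> dist x y * norm e"
  proof (rule predual_norm_le)
    fix f assume f: "f \<in> B" "normB f \<le> 1"
    have "norm (f x - f y) \<le> 1 * dist x y"
      using norm_diff_le_Lip[OF B_Lip0[OF f(1)], of x y] Lip_le_normB[OF f(1)] f(2)
      by (meson mult_right_mono order_trans zero_le_dist)
    then have "norm (f x - f y) * norm e \<le> dist x y * norm e" by (simp add: mult_right_mono)
    with norm_blinfun[of "f x - f y" e] show "norm (elem_tensor x0 smul x y e f) \<le> dist x y * norm e"
      using B_Lip0[OF f(1)] by (simp add: elem_tensor_def)
  qed
next
  obtain \<phi> where \<phi>: "\<phi> \<in> dual smul" "norm \<phi> \<le> 1" "norm (blinfun_apply \<phi> e) = norm e"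
    using ex_norming_dual[OF smul] by metis
  define g where "g = (\<lambda>z. of_real (dist z y - dist x0 y) :: 'k)"
  have "1-lipschitz_on UNIV g"
  proof (rule lipschitz_onI)
    fix a b
    have "g a - g b = of_real (dist a y - dist b y)" by (simp add: g_def)
    then show "dist (g a) (g b) \<le> 1 * dist a b"
      unfolding dist_norm using abs_dist_diff_le[of a y b] dist_commute[of y b]
      by (simp only: norm_of_real)
  qed simp
  then have g: "g \<in> Lip0 x0 UNIV" "Lip g \<le> 1" by (auto simp: Lip0_def g_def Lip_le)
  let ?f = "\<lambda>z. dual_scale (g z) \<phi>"
  have f: "?f \<in> B" "normB ?f \<le> 1"
    using rank_one[OF g(1) \<phi>(1)] mult_mono[OF g(2) \<phi>(2)] by auto
  have "elem_tensor x0 smul x y e ?f = of_real (dist x y) * blinfun_apply \<phi> e"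
    unfolding elem_tensor_apply[OF B_Lip0[OF f(1)]] dual_scale_apply
    by (simp add: g_def algebra_simps)
  then have "norm (elem_tensor x0 smul x y e ?f) = dist x y * norm e"
    by (simp add: norm_mult \<phi>(3))
  with norm_le_predual_norm_unit[OF elem_tensor_in_lip_tensor f, of x y e]
  show "dist x y * norm e \<le> \<alpha>\<^sub>B (elem_tensor x0 smul x y e)" by simp
qed

lemma lip_cross_norm_predual_norm: "lip_cross_norm x0 smul \<alpha>\<^sub>B"
  unfolding lip_cross_norm_def norm_on_def
proof (intro conjI ballI allI)
  fix u assume u: "u \<in> lip_tensor x0 smul"
  then show "0 \<le> \<alpha>\<^sub>B u" by (rule predual_norm_nonneg)
  show "\<alpha>\<^sub>B u = 0 \<longleftrightarrow> u = 0"
  proof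
    assume "\<alpha>\<^sub>B u = 0"
    then have "u f = 0" if "f \<in> B" for f using norm_le_predual_norm[OF u that] by simp
    then show "u = 0" by (rule lip_tensor_eq_0_if_vanishing_on_B[OF u])
  next
    assume "u = 0"
    then have "\<alpha>\<^sub>B u \<le> 0" by (intro predual_norm_le) simp
    with predual_norm_nonneg[OF u] show "\<alpha>\<^sub>B u = 0" by simp
  qed
  show "\<alpha>\<^sub>B (u + w) \<le> \<alpha>\<^sub>B u + \<alpha>\<^sub>B w" if w: "w \<in> lip_tensor x0 smul" for w
  proof (rule predual_norm_le)
    fix f assume f: "f \<in> B" "normB f \<le> 1"
    show "norm ((u + w) f) \<le> \<alpha>\<^sub>B u + \<alpha>\<^sub>B w"
      using norm_triangle_ineq[of "u f" "w f"] norm_le_predual_norm_unit[OF u f]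
        norm_le_predual_norm_unit[OF w f] by simp
  qed
  have scale_le: "\<alpha>\<^sub>B (functional_scale a w) \<le> norm a * \<alpha>\<^sub>B w" if "w \<in> lip_tensor x0 smul" for a w
  proof (rule predual_norm_le)
    fix f assume "f \<in> B" "normB f \<le> 1"
    then show "norm (functional_scale a w f) \<le> norm a * \<alpha>\<^sub>B w"
      using norm_le_predual_norm_unit[OF that]
      by (simp add: functional_scale_def norm_mult mult_left_mono)
  qed
  show "\<alpha>\<^sub>B (functional_scale a u) = norm a * \<alpha>\<^sub>B u" for a
  proof (cases "a = 0")
    case True
    have "functional_scale a u \<in> lip_tensor x0 smul"
      by (rule functional.subspace_scale[OF lip_tensor_subspace u])
    then show ?thesis using scale_le[OF u, of a] predual_norm_nonneg True by fastforce
  next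
    case False
    have au: "functional_scale a u \<in> lip_tensor x0 smul"
      by (rule functional.subspace_scale[OF lip_tensor_subspace u])
    have "functional_scale (inverse a) (functional_scale a u) = u" using False by simp
    with scale_le[OF au, of "inverse a"] False
    have "norm a * \<alpha>\<^sub>B u \<le> \<alpha>\<^sub>B (functional_scale a u)"
      by (simp add: norm_divide field_simps)
    with scale_le[OF u, of a] show ?thesis by simp
  qed
next
  show "\<alpha>\<^sub>B (elem_tensor x0 smul x y e) = dist x y * norm e" for x y e
    by (rule predual_norm_elem_tensor)
qed

lemma dualizable_predual_norm: "dualizable x0 smul \<alpha>\<^sub>B"
  unfolding dualizable_def
proof (intro ballI allI)
  fix g :: "'x \<Rightarrow> 'k" and \<phi> and n :: nat and x y :: "nat \<Rightarrow> 'x" and e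
  assume g: "g \<in> Lip0 x0 UNIV" and \<phi>: "\<phi> \<in> dual smul"
  let ?f = "\<lambda>x. dual_scale (g x) \<phi>" and ?u = "\<Sum>i<n. elem_tensor x0 smul (x i) (y i) (e i)"
  have "?u ?f = (\<Sum>i<n. (g (x i) - g (y i)) * blinfun_apply \<phi> (e i))"
    using B_Lip0[OF rank_one(1)[OF g \<phi>]]
    by (simp add: sum_elem_tensor_apply blinfun.diff_left dual_scale_apply algebra_simps)
  with norm_le_predual_norm[OF sum_elem_tensor_in_lip_tensor rank_one(1)[OF g \<phi>], of x y e "{..<n}"]
  show "norm (\<Sum>i<n. (g (x i) - g (y i)) * blinfun_apply \<phi> (e i)) \<le> Lip g * norm \<phi> * \<alpha>\<^sub>B ?u"
    by (simp add: rank_one(2)[OF g \<phi>])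
qed

text \<open>A bipolar argument. The values of the ball of radius \<open>C\<close> on finitely many tensors form an
  absolutely convex bounded set of coordinates. If the values of \<open>f\<close> stayed away from it, the
  coefficients of a separating functional would combine these tensors to a single \<open>w\<close> with
  \<open>C * \<alpha>\<^sub>B w < norm (w f)\<close>.\<close>

lemma ball_approximates:
  assumes C: "C \<ge> 0" and f: "\<And>w. w \<in> lip_tensor x0 smul \<Longrightarrow> norm (w f) \<le> C * \<alpha>\<^sub>B w"
    and U: "finite U" "U \<subseteq> lip_tensor x0 smul" and \<epsilon>: "\<epsilon> > 0"
  shows "\<exists>h\<in>B. normB h \<le> C \<and> (\<forall>u\<in>U. norm (u h - u f) < \<epsilon>)"
proof (rule ccontr)
  assume contra: "\<not> ?thesis"
  define K where "K = {z. \<exists>h\<in>B. normB h \<le> C \<and> (\<forall>u\<in>U. z u = u h)}"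
  obtain c \<delta> where \<delta>: "\<delta> > 0"
    and sep: "\<And>z. z \<in> K \<Longrightarrow> norm (\<Sum>u\<in>U. c u * z u) + \<delta> \<le> norm (\<Sum>u\<in>U. c u * u f)"
  proof (rule separation_finite[where K = K and J = U and t = "\<lambda>u. u f" and \<epsilon> = \<epsilon>
        and M = "Max (insert 0 ((\<lambda>u. C * \<alpha>\<^sub>B u) ` U))", OF _ _ _ \<epsilon> _ U(1)])
    show "K \<noteq> {}"
      using zero_in_B normB_zero C by (auto simp: K_def intro!: exI[of _ "\<lambda>u. u 0"] bexI[of _ 0])
    show "(\<lambda>u. a * y u + b * z u) \<in> K" if yz: "y \<in> K" "z \<in> K" and ab: "norm a + norm b \<le> 1"
      for y z a b
    proof -
      from yz obtain h k where h: "h \<in> B" "normB h \<le> C" "\<forall>u\<in>U. y u = u h"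
        and k: "k \<in> B" "normB k \<le> C" "\<forall>u\<in>U. z u = u k" by (auto simp: K_def)
      let ?l = "op_scale a h + op_scale b k"
      have in_B: "op_scale a h \<in> B" "op_scale b k \<in> B"
        using h k by (auto intro: op.subspace_scale[OF B_subspace])
      have "normB ?l \<le> norm a * normB h + norm b * normB k"
        using normB_triangle[OF in_B] h k by (simp add: normB_scale)
      also have "\<dots> \<le> norm a * C + norm b * C"
        using h k by (intro add_mono mult_left_mono) auto
      also have "\<dots> \<le> C" using mult_right_mono[OF ab C] by (simp add: algebra_simps)
      finally have "normB ?l \<le> C" .
      moreover have "?l \<in> B" using in_B by (rule op.subspace_add[OF B_subspace])
      moreover have "\<forall>u\<in>U. a * y u + b * z u = u ?l"
        using U(2) h(1,3) k(1,3) lip_tensor_linear_on_B(1) by auto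
      ultimately show ?thesis unfolding K_def by blast
    qed
    show "norm (z u) \<le> Max (insert 0 ((\<lambda>u. C * \<alpha>\<^sub>B u) ` U))" if "z \<in> K" "u \<in> U" for z u
    proof -
      from that obtain h where h: "h \<in> B" "normB h \<le> C" "z u = u h" by (auto simp: K_def)
      have u: "u \<in> lip_tensor x0 smul" using that U by auto
      have "norm (z u) \<le> C * \<alpha>\<^sub>B u"
        using norm_le_predual_norm[OF u h(1)] mult_right_mono[OF h(2) predual_norm_nonneg[OF u]] h(3)
        by simp
      also have "\<dots> \<le> Max (insert 0 ((\<lambda>u. C * \<alpha>\<^sub>B u) ` U))"
        by (rule Max_ge) (use U that in auto)
      finally show ?thesis .
    qed
    show "\<exists>u\<in>U. \<epsilon> \<le> norm (z u - u f)" if "z \<in> K" for z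
    proof -
      from that obtain h where h: "h \<in> B" "normB h \<le> C" "\<forall>u\<in>U. z u = u h" by (auto simp: K_def)
      with contra obtain u where "u \<in> U" "\<not> norm (u h - u f) < \<epsilon>" by blast
      with h show ?thesis by (auto simp: not_less)
    qed
  next
    fix c \<delta>
    assume "\<delta> > 0" "\<And>z. z \<in> K \<Longrightarrow> norm (\<Sum>u\<in>U. c u * z u) + \<delta> \<le> norm (\<Sum>u\<in>U. c u * u f)"
    then show thesis by (rule that)
  qed
  define w where "w = (\<Sum>u\<in>U. functional_scale (c u) u)"
  have w: "w \<in> lip_tensor x0 smul"
    unfolding w_def using U by (intro functional.subspace_sum functional.subspace_scale lip_tensor_subspace) auto
  have w_apply: "w g = (\<Sum>u\<in>U. c u * u g)" for g
    by (simp add: w_def sum_fun_apply functional_scale_def)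
  have ball: "norm (w h) \<le> norm (w f) - \<delta>" if "h \<in> B" "normB h \<le> C" for h
  proof -
    have "(\<lambda>u. u h) \<in> K" using that by (auto simp: K_def)
    from sep[OF this] show ?thesis by (simp add: w_apply)
  qed
  have "C * \<alpha>\<^sub>B w \<le> norm (w f) - \<delta>"
  proof (cases "C = 0")
    case True
    then show ?thesis
      using ball[OF zero_in_B] normB_zero lip_tensor_linear_on_B(3)[OF w zero_in_B zero_in_B] by simp
  next
    case False
    have "\<alpha>\<^sub>B w \<le> (norm (w f) - \<delta>) / C"
    proof (rule predual_norm_le)
      fix h assume h: "h \<in> B" "normB h \<le> 1"
      let ?h = "op_scale (of_real C) h"
      have "?h \<in> B" by (rule op.subspace_scale[OF B_subspace h(1)])
      moreover have "normB ?h \<le> C"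
        using h C by (simp add: normB_scale mult_left_le)
      ultimately have "norm (w ?h) \<le> norm (w f) - \<delta>" by (rule ball)
      then show "norm (w h) \<le> (norm (w f) - \<delta>) / C"
        using C False by (simp add: lip_tensor_linear_on_B(2)[OF w h(1) h(1)] norm_mult field_simps)
    qed
    then show ?thesis using C False by (simp add: field_simps)
  qed
  with f[OF w] \<delta> show False by simp
qed

text \<open>The approximations are indexed by the basic weak* neighbourhoods of \<open>f\<close>, ordered by reverse
  inclusion.\<close>

lemma ball_weak_star_dense:
  assumes C: "C \<ge> 0" and f: "\<And>w. w \<in> lip_tensor x0 smul \<Longrightarrow> norm (w f) \<le> C * \<alpha>\<^sub>B w"
    and fL: "f \<in> Lip0 x0 (dual smul)"
  obtains \<Gamma> :: "('x, 'e, 'k, 'g) net_index set" and le F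
  where "directed_set \<Gamma> le" "\<And>\<gamma>. \<gamma> \<in> \<Gamma> \<Longrightarrow> F \<gamma> \<in> B" "\<And>\<gamma>. \<gamma> \<in> \<Gamma> \<Longrightarrow> normB (F \<gamma>) \<le> C"
    "limitin (weak_star_lip_topology x0 smul) F f (tails \<Gamma> le)"
proof -
  define W where "W = (\<lambda>(U :: (('x \<Rightarrow> ('e \<Rightarrow>\<^sub>L 'k)) \<Rightarrow> 'k) set) \<epsilon>.
    {h \<in> Lip0 x0 (dual smul). \<forall>u\<in>U. norm (u h - u f) < \<epsilon>})"
  define \<Gamma> :: "('x, 'e, 'k, 'g) net_index set" where
    "\<Gamma> = {Inl (W U \<epsilon>) | U \<epsilon>. finite U \<and> U \<subseteq> lip_tensor x0 smul \<and> \<epsilon> > 0}"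
  define le :: "('x, 'e, 'k, 'g) net_index \<Rightarrow> ('x, 'e, 'k, 'g) net_index \<Rightarrow> bool" where
    "le = (\<lambda>i j. projl j \<subseteq> projl i)"
  have "\<exists>h. h \<in> B \<and> normB h \<le> C \<and> h \<in> projl i" if "i \<in> \<Gamma>" for i
  proof -
    from that obtain U \<epsilon> where i: "i = Inl (W U \<epsilon>)" "finite U" "U \<subseteq> lip_tensor x0 smul" "\<epsilon> > 0"
      by (auto simp: \<Gamma>_def)
    obtain h where "h \<in> B" "normB h \<le> C" "\<forall>u\<in>U. norm (u h - u f) < \<epsilon>"
      using ball_approximates[OF C f i(2-4)] by blast
    then have "h \<in> B \<and> normB h \<le> C \<and> h \<in> projl i" by (simp add: i(1) W_def B_Lip0)
    then show ?thesis by (rule exI[of _ h])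
  qed
  then obtain F where F: "\<And>i. i \<in> \<Gamma> \<Longrightarrow> F i \<in> B \<and> normB (F i) \<le> C \<and> F i \<in> projl i"
    by metis
  have dir: "directed_set \<Gamma> le"
    unfolding directed_set_def
  proof (intro conjI ballI impI)
    have "Inl (W {} 1) \<in> \<Gamma>"
      unfolding \<Gamma>_def by (rule CollectI, rule exI[of _ "{}"], rule exI[of _ 1]) simp
    then show "\<Gamma> \<noteq> {}" by blast
  next
    fix i j assume "i \<in> \<Gamma>" "j \<in> \<Gamma>"
    then obtain U \<epsilon> V \<eta> where i: "i = Inl (W U \<epsilon>)" "finite U" "U \<subseteq> lip_tensor x0 smul" "\<epsilon> > 0"
      and j: "j = Inl (W V \<eta>)" "finite V" "V \<subseteq> lip_tensor x0 smul" "\<eta> > 0"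
      by (auto simp: \<Gamma>_def)
    let ?k = "Inl (W (U \<union> V) (min \<epsilon> \<eta>)) :: ('x, 'e, 'k, 'g) net_index"
    have "?k \<in> \<Gamma>" unfolding \<Gamma>_def using i j
      by (intro CollectI exI[of _ "U \<union> V"] exI[of _ "min \<epsilon> \<eta>"]) auto
    moreover have "le i ?k" "le j ?k" by (auto simp: le_def i(1) j(1) W_def)
    ultimately show "\<exists>k\<in>\<Gamma>. le i k \<and> le j k" by blast
  qed (auto simp: le_def)
  have "((\<lambda>i. u (F i)) \<longlongrightarrow> u f) (tails \<Gamma> le)" if u: "u \<in> lip_tensor x0 smul" for u
  proof (rule tendstoI)
    fix \<epsilon> :: real assume "\<epsilon> > 0"
    then have i: "Inl (W {u} \<epsilon>) \<in> \<Gamma>" using u by (auto simp: \<Gamma>_def)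
    have "dist (u (F j)) (u f) < \<epsilon>" if "j \<in> \<Gamma>" "le (Inl (W {u} \<epsilon>)) j" for j
      using F[OF that(1)] that(2) by (auto simp: le_def W_def dist_norm)
    with i show "\<forall>\<^sub>F i in tails \<Gamma> le. dist (u (F i)) (u f) < \<epsilon>"
      unfolding eventually_tails[OF dir] by blast
  qed
  then have "limitin (weak_star_lip_topology x0 smul) F f (tails \<Gamma> le)"
    using F B_Lip0 fL by (subst limitin_weak_star_lip_topology[OF dir]) auto
  with dir F show ?thesis by (intro that[of \<Gamma> le F]) auto
qed

end

section \<open>Operators bounded by a cross-norm\<close>

lemma lip_cross_norm_nonneg:
  "lip_cross_norm x0 smul \<alpha> \<Longrightarrow> u \<in> lip_tensor x0 smul \<Longrightarrow> 0 \<le> \<alpha> u"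
  unfolding lip_cross_norm_def norm_on_def by (elim conjE) (erule bspec)

lemma Lip_alpha_subset_Lip0:
  assumes cross: "lip_cross_norm x0 smul \<alpha>"
  shows "Lip_alpha x0 smul \<alpha> \<subseteq> Lip0 x0 (dual smul)"
proof
  fix f assume f: "f \<in> Lip_alpha x0 smul \<alpha>"
  then obtain C where C: "alpha_bound x0 smul \<alpha> f C" by (auto simp: Lip_alpha_def)
  have "norm (f x - f y) \<le> C * dist x y" for x y
  proof (rule norm_blinfun_bound)
    show "0 \<le> C * dist x y" using C by (simp add: alpha_bound_def)
    fix e
    have "norm (\<Sum>i<1::nat. blinfun_apply (f x - f y) e)
        \<le> C * \<alpha> (\<Sum>i<1::nat. elem_tensor x0 smul x y e)"
      using C unfolding alpha_bound_def
      by (elim conjE allE[of _ 1] allE[of _ "\<lambda>_. x"] allE[of _ "\<lambda>_. y"] allE[of _ "\<lambda>_. e"])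
    then show "norm (blinfun_apply (f x - f y) e) \<le> C * dist x y * norm e"
      using cross by (simp add: lip_cross_norm_def mult.assoc)
  qed
  then have "C-lipschitz_on UNIV f"
    using C by (intro lipschitz_onI) (auto simp: dist_norm alpha_bound_def)
  with f show "f \<in> Lip0 x0 (dual smul)" by (auto simp: Lip_alpha_def Lip0_def)
qed

text \<open>Every tensor is a finite sum of elementary ones, so the bound defining an \<open>\<alpha>\<close>-Lipschitz operator
  says that evaluation at \<open>f\<close> is a functional of norm at most \<open>C\<close> on the tensor product.\<close>

lemma alpha_bound_iff:
  assumes f: "f \<in> Lip0 x0 (dual smul)"
  shows "alpha_bound x0 smul \<alpha> f C \<longleftrightarrow>
    0 \<le> C \<and> (\<forall>u\<in>lip_tensor x0 smul. norm (u f) \<le> C * \<alpha> u)"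
proof
  assume C: "alpha_bound x0 smul \<alpha> f C"
  have "norm (u f) \<le> C * \<alpha> u" if u: "u \<in> lip_tensor x0 smul" for u
  proof -
    obtain n :: nat and x y e where "u = (\<Sum>i<n. elem_tensor x0 smul (x i) (y i) (e i))"
      using lip_tensor_eq_sum[OF u] .
    then show ?thesis using C by (simp add: alpha_bound_def sum_elem_tensor_apply[OF f])
  qed
  with C show "0 \<le> C \<and> (\<forall>u\<in>lip_tensor x0 smul. norm (u f) \<le> C * \<alpha> u)"
    by (simp add: alpha_bound_def)
next
  assume C: "0 \<le> C \<and> (\<forall>u\<in>lip_tensor x0 smul. norm (u f) \<le> C * \<alpha> u)"
  show "alpha_bound x0 smul \<alpha> f C"
    unfolding alpha_bound_def
  proof (intro conjI allI)
    fix n :: nat and x y e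
    show "norm (\<Sum>i<n. blinfun_apply (f (x i) - f (y i)) (e i))
        \<le> C * \<alpha> (\<Sum>i<n. elem_tensor x0 smul (x i) (y i) (e i))"
      using bspec[OF conjunct2[OF C] sum_elem_tensor_in_lip_tensor]
      by (simp only: sum_elem_tensor_apply[OF f])
  qed (use C in simp)
qed

lemma alpha_bound_Lip_alpha_norm:
  assumes cross: "lip_cross_norm x0 smul \<alpha>" and f: "f \<in> Lip_alpha x0 smul \<alpha>"
  shows "alpha_bound x0 smul \<alpha> f (Lip_alpha_norm x0 smul \<alpha> f)"
proof -
  have fL: "f \<in> Lip0 x0 (dual smul)" using Lip_alpha_subset_Lip0[OF cross] f by blast
  have ne: "{C. alpha_bound x0 smul \<alpha> f C} \<noteq> {}" using f by (auto simp: Lip_alpha_def)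
  have "norm (u f) \<le> Lip_alpha_norm x0 smul \<alpha> f * \<alpha> u" if u: "u \<in> lip_tensor x0 smul" for u
  proof (cases "\<alpha> u = 0")
    case True
    then show ?thesis using ne u by (auto simp: alpha_bound_iff[OF fL])
  next
    case False
    then have pos: "\<alpha> u > 0"
      using lip_cross_norm_nonneg[OF cross u] by simp
    have "norm (u f) / \<alpha> u \<le> Lip_alpha_norm x0 smul \<alpha> f"
      unfolding Lip_alpha_norm_def
      by (rule cInf_greatest[OF ne]) (use u pos in \<open>auto simp: alpha_bound_iff[OF fL] divide_le_eq\<close>)
    then show ?thesis using pos by (simp add: divide_le_eq)
  qed
  moreover have "0 \<le> Lip_alpha_norm x0 smul \<alpha> f"
    unfolding Lip_alpha_norm_def
    by (rule cInf_greatest[OF ne]) (auto simp: alpha_bound_def)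
  ultimately show ?thesis by (simp add: alpha_bound_iff[OF fL])
qed

lemma Lip_alpha_norm_le: "alpha_bound x0 smul \<alpha> f C \<Longrightarrow> Lip_alpha_norm x0 smul \<alpha> f \<le> C"
  unfolding Lip_alpha_norm_def
  by (rule cInf_lower) (auto intro!: bdd_belowI[of _ 0] simp: alpha_bound_def)

text \<open>For each tensor \<open>u\<close> the inequality \<open>norm (u f) \<le> M * \<alpha> u\<close> involves only the value \<open>u f\<close>, so it
  survives pointwise limits.\<close>

lemma Lip_alpha_weak_star_limit:
  fixes f :: "'x::metric_space \<Rightarrow> ('e::banach \<Rightarrow>\<^sub>L 'k::real_or_complex)"
  assumes cross: "lip_cross_norm x0 smul \<alpha>" and f: "f \<in> Lip0 x0 (dual smul)"
    and dir: "directed_set \<Gamma> le" and F: "\<And>\<gamma>. \<gamma> \<in> \<Gamma> \<Longrightarrow> F \<gamma> \<in> Lip_alpha x0 smul \<alpha>"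
    and M: "\<And>\<gamma>. \<gamma> \<in> \<Gamma> \<Longrightarrow> Lip_alpha_norm x0 smul \<alpha> (F \<gamma>) \<le> M"
    and lim: "limitin (weak_star_lip_topology x0 smul) F f (tails \<Gamma> le)"
  shows "alpha_bound x0 smul \<alpha> f M"
proof -
  have FL: "F \<gamma> \<in> Lip0 x0 (dual smul)" if "\<gamma> \<in> \<Gamma>" for \<gamma>
    using Lip_alpha_subset_Lip0[OF cross] F[OF that] by blast
  have bound: "0 \<le> Lip_alpha_norm x0 smul \<alpha> (F \<gamma>)"
      "u \<in> lip_tensor x0 smul \<Longrightarrow> norm (u (F \<gamma>)) \<le> Lip_alpha_norm x0 smul \<alpha> (F \<gamma>) * \<alpha> u"
    if "\<gamma> \<in> \<Gamma>" for \<gamma> u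
    using alpha_bound_Lip_alpha_norm[OF cross F[OF that]] by (auto simp: alpha_bound_iff[OF FL[OF that]])
  have conv: "\<forall>u\<in>lip_tensor x0 smul. ((\<lambda>\<gamma>. u (F \<gamma>)) \<longlongrightarrow> u f) (tails \<Gamma> le)"
    by (rule iffD1[OF limitin_weak_star_lip_topology[OF dir FL f] lim])
  have "\<Gamma> \<noteq> {}" and refl: "\<forall>i\<in>\<Gamma>. le i i" using dir by (simp_all add: directed_set_def)
  then obtain \<gamma>0 where \<gamma>0: "\<gamma>0 \<in> \<Gamma>" by blast
  have "\<not> eventually (\<lambda>_. False) (tails \<Gamma> le)"
    unfolding eventually_tails[OF dir] using refl by blast
  then have nontriv: "tails \<Gamma> le \<noteq> bot" by (simp add: trivial_limit_def)
  have "norm (u f) \<le> M * \<alpha> u" if u: "u \<in> lip_tensor x0 smul" for u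
  proof (rule tendsto_upperbound[OF _ _ nontriv])
    show "((\<lambda>\<gamma>. norm (u (F \<gamma>))) \<longlongrightarrow> norm (u f)) (tails \<Gamma> le)"
      by (rule tendsto_norm[OF bspec[OF conv u]])
    have "norm (u (F \<gamma>)) \<le> M * \<alpha> u" if "\<gamma> \<in> \<Gamma>" for \<gamma>
    proof -
      have "0 \<le> \<alpha> u" by (rule lip_cross_norm_nonneg[OF cross u])
      then have "Lip_alpha_norm x0 smul \<alpha> (F \<gamma>) * \<alpha> u \<le> M * \<alpha> u"
        by (rule mult_right_mono[OF M[OF that]])
      with bound(2)[OF that u] show ?thesis by (rule order_trans)
    qed
    then show "\<forall>\<^sub>F \<gamma> in tails \<Gamma> le. norm (u (F \<gamma>)) \<le> M * \<alpha> u"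
      unfolding eventually_tails[OF dir] using \<gamma>0 by blast
  qed
  moreover have "0 \<le> M" using bound(1)[OF \<gamma>0] M[OF \<gamma>0] by simp
  ultimately show ?thesis by (simp add: alpha_bound_iff[OF f])
qed

theorem theorem6p5:
  fixes x0 :: "'x::metric_space"
    and smul :: "'k::real_or_complex \<Rightarrow> 'e::banach \<Rightarrow> 'e"
    and B :: "('x \<Rightarrow> ('e \<Rightarrow>\<^sub>L 'k)) set"
    and normB :: "('x \<Rightarrow> ('e \<Rightarrow>\<^sub>L 'k)) \<Rightarrow> real"
  assumes "banach_over smul"
    and "lip_operator_banach x0 smul B normB"
  shows
    "(\<exists>\<alpha>. lip_cross_norm x0 smul \<alpha> \<and> dualizable x0 smul \<alpha> \<and>
        B = Lip_alpha x0 smul \<alpha> \<and> (\<forall>f\<in>B. normB f = Lip_alpha_norm x0 smul \<alpha> f))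
     \<longleftrightarrow>
     (\<forall>f \<in> Lip0 x0 (dual smul).
        \<forall>(\<Gamma> :: ('x, 'e, 'k, 'g) net_index set) le F.
          directed_set \<Gamma> le \<and> (\<forall>\<gamma>\<in>\<Gamma>. F \<gamma> \<in> B) \<and> (\<exists>M. \<forall>\<gamma>\<in>\<Gamma>. normB (F \<gamma>) \<le> M) \<and>
          limitin (weak_star_lip_topology x0 smul) F f (tails \<Gamma> le)
          \<longrightarrow> f \<in> B \<and> normB f \<le> (SUP \<gamma>\<in>\<Gamma>. normB (F \<gamma>)))"
    (is "?dual \<longleftrightarrow> ?closed")
proof
  assume ?dual
  then obtain \<alpha> where cross: "lip_cross_norm x0 smul \<alpha>" and B: "B = Lip_alpha x0 smul \<alpha>"
    and normB: "\<And>f. f \<in> B \<Longrightarrow> normB f = Lip_alpha_norm x0 smul \<alpha> f" by blast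
  show ?closed
  proof (intro ballI allI impI, elim conjE exE)
    fix f and \<Gamma> :: "('x, 'e, 'k, 'g) net_index set" and le F M
    assume f: "f \<in> Lip0 x0 (dual smul)" and dir: "directed_set \<Gamma> le"
      and F: "\<forall>\<gamma>\<in>\<Gamma>. F \<gamma> \<in> B" and M: "\<forall>\<gamma>\<in>\<Gamma>. normB (F \<gamma>) \<le> M"
      and lim: "limitin (weak_star_lip_topology x0 smul) F f (tails \<Gamma> le)"
    let ?S = "SUP \<gamma>\<in>\<Gamma>. normB (F \<gamma>)"
    have "bdd_above ((\<lambda>\<gamma>. normB (F \<gamma>)) ` \<Gamma>)" using M by (intro bdd_aboveI2) blast
    then have "normB (F \<gamma>) \<le> ?S" if "\<gamma> \<in> \<Gamma>" for \<gamma> using that by (rule cSUP_upper[rotated])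
    then have bound: "alpha_bound x0 smul \<alpha> f ?S"
      using F by (intro Lip_alpha_weak_star_limit[OF cross f dir _ _ lim]) (simp_all add: normB flip: B)
    then have "f \<in> B" using f by (auto simp: B Lip_alpha_def Lip0_def)
    with Lip_alpha_norm_le[OF bound] show "f \<in> B \<and> normB f \<le> ?S" by (simp add: normB)
  qed
next
  assume closed: ?closed
  let ?\<alpha> = "predual_norm B normB"
  note cross = lip_cross_norm_predual_norm[OF assms]
  have ball: "f \<in> B \<and> normB f \<le> C"
    if f: "f \<in> Lip0 x0 (dual smul)" and C: "alpha_bound x0 smul ?\<alpha> f C" for f C
  proof -
    have C': "0 \<le> C" "\<And>w. w \<in> lip_tensor x0 smul \<Longrightarrow> norm (w f) \<le> C * ?\<alpha> w"
      using C by (auto simp: alpha_bound_iff[OF f])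
    obtain \<Gamma> :: "('x, 'e, 'k, 'g) net_index set" and le F
      where net: "directed_set \<Gamma> le" "\<And>\<gamma>. \<gamma> \<in> \<Gamma> \<Longrightarrow> F \<gamma> \<in> B" "\<And>\<gamma>. \<gamma> \<in> \<Gamma> \<Longrightarrow> normB (F \<gamma>) \<le> C"
        "limitin (weak_star_lip_topology x0 smul) F f (tails \<Gamma> le)"
      using ball_weak_star_dense[OF assms C' f] by blast
    then have "f \<in> B \<and> normB f \<le> (SUP \<gamma>\<in>\<Gamma>. normB (F \<gamma>))" using closed f by blast
    moreover have "(SUP \<gamma>\<in>\<Gamma>. normB (F \<gamma>)) \<le> C"
      using net(1,3) by (intro cSUP_least) (auto simp: directed_set_def)
    ultimately show ?thesis by auto
  qed
  have bound: "alpha_bound x0 smul ?\<alpha> f (normB f)" if f: "f \<in> B" for f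
    using norm_le_predual_norm[OF assms _ f] normB_nonneg[OF assms f]
    by (simp add: alpha_bound_iff[OF B_Lip0[OF assms f]])
  have B: "B = Lip_alpha x0 smul ?\<alpha>"
  proof (intro equalityI subsetI)
    fix f assume f: "f \<in> B"
    then show "f \<in> Lip_alpha x0 smul ?\<alpha>"
      using bound[OF f] B_Lip0[OF assms f] by (auto simp: Lip_alpha_def Lip0_def)
  next
    fix f assume f: "f \<in> Lip_alpha x0 smul ?\<alpha>"
    then have "f \<in> Lip0 x0 (dual smul)" using Lip_alpha_subset_Lip0[OF cross] by blast
    with f ball show "f \<in> B" by (auto simp: Lip_alpha_def)
  qed
  have "normB f = Lip_alpha_norm x0 smul ?\<alpha> f" if f: "f \<in> B" for f
  proof (rule antisym)
    show "normB f \<le> Lip_alpha_norm x0 smul ?\<alpha> f"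
      using ball[OF B_Lip0[OF assms f] alpha_bound_Lip_alpha_norm[OF cross]] f B by simp
    show "Lip_alpha_norm x0 smul ?\<alpha> f \<le> normB f" by (rule Lip_alpha_norm_le[OF bound[OF f]])
  qed
  with cross dualizable_predual_norm[OF assms] B show ?dual by blast
qed

end
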